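(* Let $(\bar X,\bar\sigma)$ be the two-sided minimal shift generated by a primitive substitution on $k$ letters, and assume $\bar X$ is infinite. Then any automorphism $\Phi$ of $(\bar X,\bar\sigma)$ is an at most $k^2$-th root of a power of the shift; that is, there exist an integer $m$ with $1\le m\le k^2$ and an $n\in\mathbb Z$ such that $\Phi^m=\bar\sigma^n$.
   Context: Let $\mathcal A$ be a finite alphabet with $k$ letters. A substitution $\theta$ on $\mathcal A$ assigns to each letter a nonempty finite word over $\mathcal A$, and is extended to words by concatenation. It is primitive if there is $j\ge 1$ such that for all letters $a,b\in\mathcal A$, the letter $b$ occurs in $\theta^j(a)$. The two-sided shift generated by $\theta$ is the set $\bar X\subseteq\mathcal A^{\mathbb Z}$ of all bi-infinite sequences each of whose finite words occurs in $\theta^j(a)$ for some $j\ge 1$ and some $a\in\mathcal A$, with the left shift $\bar\sigma$; it is minimal (every orbit is dense). An automorphism of $(\bar X,\bar\sigma)$ is a continuous bijection $\bar X\to\bar X$ (with $\bar X$ carrying the topology induced by the product topology) commuting with $\bar\sigma$. *)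

theory Defs
  imports "HOL-Analysis.Analysis" "HOL-Library.Sublist"
begin

text \<open>The alphabet is a finite type, so the number of letters is the cardinality of that type.
  Finite words are lists; two-sided sequences are functions on the integers.\<close>

definition substitution :: "('a \<Rightarrow> 'a list) \<Rightarrow> bool" where
  "substitution \<theta> \<longleftrightarrow> (\<forall>a. \<theta> a \<noteq> [])"

definition subst_word :: "('a \<Rightarrow> 'a list) \<Rightarrow> 'a list \<Rightarrow> 'a list" where
  "subst_word \<theta> w = concat (map \<theta> w)"

definition subst_iter :: "('a \<Rightarrow> 'a list) \<Rightarrow> nat \<Rightarrow> 'a \<Rightarrow> 'a list" where
  "subst_iter \<theta> j a = (subst_word \<theta> ^^ j) [a]"

definition primitive :: "('a \<Rightarrow> 'a list) \<Rightarrow> bool" where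
  "primitive \<theta> \<longleftrightarrow> (\<exists>j\<ge>1. \<forall>a b. b \<in> set (subst_iter \<theta> j a))"

text \<open>The word \<open>map x [i..j]\<close> is \<open>x i, \<dots>, x j\<close> (empty if \<open>j < i\<close>), and
  \<open>sublist\<close> means contiguous occurrence.\<close>

definition subst_shift :: "('a \<Rightarrow> 'a list) \<Rightarrow> (int \<Rightarrow> 'a) set" where
  "subst_shift \<theta> =
     {x. \<forall>i j. \<exists>m\<ge>1. \<exists>a. sublist (map x [i..j]) (subst_iter \<theta> m a)}"

definition shift :: "(int \<Rightarrow> 'a) \<Rightarrow> int \<Rightarrow> 'a" where
  "shift x = (\<lambda>i. x (i + 1))"

text \<open>The shift is a bijection of the full space of sequences, so \<open>inv shift\<close> is its
  two-sided inverse.\<close>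

definition shift_power :: "int \<Rightarrow> (int \<Rightarrow> 'a) \<Rightarrow> int \<Rightarrow> 'a" where
  "shift_power n = (if n \<ge> 0 then shift ^^ nat n else inv shift ^^ nat (- n))"

definition seq_topology :: "(int \<Rightarrow> 'a) topology" where
  "seq_topology = product_topology (\<lambda>_. discrete_topology UNIV) UNIV"

text \<open>Only the values of \<open>\<Phi>\<close> on \<open>X\<close> matter.\<close>

definition shift_automorphism ::
    "(int \<Rightarrow> 'a) set \<Rightarrow> ((int \<Rightarrow> 'a) \<Rightarrow> (int \<Rightarrow> 'a)) \<Rightarrow> bool" where
  "shift_automorphism X \<Phi> \<longleftrightarrow>
     bij_betw \<Phi> X X \<and>
     continuous_map (subtopology seq_topology X) (subtopology seq_topology X) \<Phi> \<and>
     (\<forall>x\<in>X. \<Phi> (shift x) = shift (\<Phi> x))"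

lemma inv_shift: "inv shift = (\<lambda>x i. x (i - 1))"
  by (rule inv_equality) (simp_all add: shift_def)

lemma shift_power_apply: "shift_power n x i = x (i + n)"
proof -
  have "(shift ^^ k) x i = x (i + int k)" for k i
    by (induction k arbitrary: i) (simp_all add: shift_def algebra_simps)
  moreover have "(inv shift ^^ k) x i = x (i - int k)" for k i
    by (induction k arbitrary: i) (simp_all add: inv_shift algebra_simps)
  ultimately show ?thesis by (simp add: shift_power_def)
qed

end

theory Submission
  imports Defs
begin

text \<open>
  Since the shift is infinite, it contains points \<open>x \<noteq> y\<close> that agree on a right half-line, and so
  do \<open>\<Phi>\<^sup>i x\<close> and \<open>\<Phi>\<^sup>i y\<close> for all \<open>i\<close>. It suffices to find \<open>i < j \<le> k\<^sup>2\<close> such that the right tails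
  of \<open>\<Phi>\<^sup>i x\<close> and \<open>\<Phi>\<^sup>j x\<close>, starting where the pairs begin to agree, coincide: then \<open>\<Phi>\<^sup>j\<^sup>-\<^sup>i\<close> is a power
  of the shift on a tail of \<open>\<Phi>\<^sup>i x\<close>, hence everywhere, as \<open>\<Phi>\<close> has a local rule and every word of
  the shift occurs in this tail.

  To find them, fix \<open>p\<close> and consider the graph with a path labelled \<open>\<theta>\<^sup>p(a)\<close> from \<open>a\<close> to \<open>b\<close> for
  all letters \<open>a\<close>, \<open>b\<close>, which has at most \<open>k\<^sup>2\<close> more edges than vertices. Stallings folding of edges
  with the same label and target does not increase this difference, so the folded graph has at most
  \<open>k\<^sup>2\<close> vertices with two incoming edges. Each point desubstitutes to a path in the graph. If the two
  paths of an asymptotic pair meet somewhere in the common tail, then in the folded graph they agree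
  back to the position where the pair differs, and there they pass through one of the \<open>k\<^sup>2\<close>
  branching vertices, which determines the first \<open>min \<bar>\<theta>\<^sup>p(a)\<bar>\<close> letters of the tail. Now use the
  pigeonhole principle and let \<open>p\<close> tend to infinity.

  That the paths meet for infinitely many \<open>p\<close> is a form of Mosse's recognizability theorem: if the
  letters following the first cuts of both points are the same at levels \<open>q\<^sub>1 < q\<^sub>2\<close>, then at level
  \<open>q\<^sub>2 - q\<^sub>1\<close> both have a common cut, as otherwise the tail would contain a long repetition, contrary
  to linear recurrence.
\<close>

section \<open>Words and compactness\<close>

lemma subst_word_simps [simp]:
  "subst_word W [] = []" "subst_word W (a # w) = W a @ subst_word W w"
  "subst_word W (u @ v) = subst_word W u @ subst_word W v"
  by (simp_all add: subst_word_def)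

lemma funpow_subst_word: "(subst_word \<theta> ^^ q) w = subst_word (subst_iter \<theta> q) w"
proof -
  have app: "(subst_word \<theta> ^^ q) (u @ v) = (subst_word \<theta> ^^ q) u @ (subst_word \<theta> ^^ q) v" for u v
    by (induction q) simp_all
  have nil: "(subst_word \<theta> ^^ q) [] = []" by (induction q) simp_all
  show ?thesis
  proof (induction w)
    case (Cons a w)
    then show ?case using app[of "[a]" w] by (simp add: subst_iter_def)
  qed (simp add: nil)
qed

lemma subst_iter_add:
  "subst_iter \<theta> (p + q) a = subst_word (subst_iter \<theta> p) (subst_iter \<theta> q a)"
  by (simp add: subst_iter_def[of _ "p + q"] subst_iter_def[of _ q] funpow_add
      flip: funpow_subst_word)

lemma subst_iter_ne: "substitution \<theta> \<Longrightarrow> subst_iter \<theta> q a \<noteq> []"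
proof (induction q arbitrary: a)
  case (Suc q)
  have "subst_iter \<theta> (Suc q) a = subst_word (subst_iter \<theta> q) (\<theta> a)"
    using subst_iter_add[of \<theta> q 1 a] by (simp add: subst_iter_def subst_word_def)
  moreover have "\<theta> a \<noteq> []" using Suc.prems by (simp add: substitution_def)
  ultimately show ?case using Suc by (cases "\<theta> a") auto
qed (simp add: subst_iter_def)

lemma length_subst_word_ge: "(\<And>a. l \<le> length (W a)) \<Longrightarrow> l * length w \<le> length (subst_word W w)"
  by (induction w) (auto intro: add_mono)

lemma length_subst_word_le: "(\<And>a. length (W a) \<le> l) \<Longrightarrow> length (subst_word W w) \<le> l * length w"
  by (induction w) (auto intro: add_mono)

lemma length_subst_word_mem: "b \<in> set w \<Longrightarrow> length (W b) \<le> length (subst_word W w)"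
  by (induction w) auto

lemma sublist_subst_word: "sublist u v \<Longrightarrow> sublist (subst_word W u) (subst_word W v)"
  unfolding sublist_def by (metis subst_word_simps(3))

text \<open>Diagonal argument: the sequences indexed by the nested infinite sets \<open>A N\<close>
  agree on the window from \<open>-N\<close> to \<open>N\<close>, and \<open>g\<close> collects
  their common values.\<close>

lemma cluster_point:
  fixes f :: "nat \<Rightarrow> int \<Rightarrow> 'b"
  assumes S: "finite S" "\<And>n t. f n t \<in> S"
  obtains g where "\<And>N. \<exists>n\<ge>N. \<forall>t\<in>{- int N..int N}. f n t = g t"
proof -
  define P where "P N A \<longleftrightarrow> infinite A \<and> (\<forall>m\<in>A. \<forall>n\<in>A. \<forall>t\<in>{- int N..int N}. f m t = f n t)"
    for N and A :: "nat set"
  have step: "\<exists>B\<subseteq>A. infinite B \<and> (\<forall>m\<in>B. \<forall>n\<in>B. \<forall>t\<in>T. f m t = f n t)"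
    if "infinite A" "finite T" for A T
    using \<open>finite T\<close>
  proof (induction T)
    case empty
    then show ?case using \<open>infinite A\<close> by auto
  next
    case (insert t T)
    then obtain B where B: "B \<subseteq> A" "infinite B" "\<forall>m\<in>B. \<forall>n\<in>B. \<forall>t\<in>T. f m t = f n t" by blast
    have "finite ((\<lambda>n. f n t) ` B)" by (rule finite_subset[OF _ S(1)]) (use S(2) in auto)
    from pigeonhole_infinite[OF B(2) this] obtain a where
      a: "infinite {b \<in> B. f b t = f a t}" by blast
    have "\<forall>m\<in>{b \<in> B. f b t = f a t}. \<forall>n\<in>{b \<in> B. f b t = f a t}. \<forall>s\<in>insert t T. f m s = f n s"
      using B(3) by simp
    moreover have "{b \<in> B. f b t = f a t} \<subseteq> A" using B(1) by blast
    ultimately show ?case using a by blast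
  qed
  have "\<exists>A. \<forall>N. P N (A N) \<and> A (Suc N) \<subseteq> A N"
  proof (rule dependent_nat_choice)
    show "\<exists>A. P 0 A" using step[of UNIV "{- int 0..int 0}"] by (auto simp: P_def)
    show "\<exists>B. P (Suc N) B \<and> B \<subseteq> A" if "P N A" for N A
    proof -
      have "infinite A" using that by (simp add: P_def)
      from step[OF this, of "{- int (Suc N)..int (Suc N)}"] show ?thesis
        unfolding P_def by blast
    qed
  qed
  then obtain A where P: "\<And>N. P N (A N)" and AS: "\<And>N. A (Suc N) \<subseteq> A N" by blast
  have anti: "A n \<subseteq> A m" if "m \<le> n" for m n using lift_Suc_antimono_le[of A, OF AS that] .
  define g where "g t = f (SOME n. n \<in> A (nat \<bar>t\<bar>)) t" for t
  have "f n t = g t" if "n \<in> A N" "t \<in> {- int N..int N}" for n N t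
  proof -
    have "A N \<subseteq> A (nat \<bar>t\<bar>)" using that by (intro anti) auto
    then have n: "n \<in> A (nat \<bar>t\<bar>)" using that by blast
    then have "(SOME n. n \<in> A (nat \<bar>t\<bar>)) \<in> A (nat \<bar>t\<bar>)" by (rule someI)
    then show ?thesis unfolding g_def using P[of "nat \<bar>t\<bar>"] n
      by (simp add: P_def) (metis abs_ge_minus_self abs_ge_self atLeastAtMost_iff minus_le_iff)
  qed
  moreover have "\<exists>n\<ge>N. n \<in> A N" for N
    using P[of N] by (auto simp: P_def infinite_nat_iff_unbounded_le)
  ultimately show ?thesis by (intro that[of g]) blast
qed

text \<open>A point of period \<open>d\<close> is determined by its values at
  \<open>0, ..., d - 1\<close>, and there are finitely many words of length
  \<open>d\<close>.\<close>

lemma finite_if_periodic: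
  fixes X :: "(int \<Rightarrow> 'a::finite) set"
  assumes d: "d \<ge> 1" and per: "\<And>y i. y \<in> X \<Longrightarrow> y (i + int d) = y i"
  shows "finite X"
proof -
  have mult: "y (i + k * int d) = y i" if "y \<in> X" for y i k
  proof (induction k rule: int_induct[where k = 0])
    case (step1 k)
    then show ?case using per[OF that, of "i + k * int d"] by (simp add: algebra_simps)
  next
    case (step2 k)
    then show ?case using per[OF that, of "i + (k - 1) * int d"] by (simp add: algebra_simps)
  qed simp
  have mod: "y i = y (int (nat (i mod int d)))" if "y \<in> X" for y i
    using mult[OF that, of "i mod int d" "i div int d"] d by simp
  have "inj_on (\<lambda>y. map (\<lambda>s. y (int s)) [0..<d]) X"
  proof (rule inj_onI, rule ext)
    fix y y' i assume *: "y \<in> X" "y' \<in> X" "map (\<lambda>s. y (int s)) [0..<d] = map (\<lambda>s. y' (int s)) [0..<d]"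
    have "nat (i mod int d) < d" using d by (simp add: nat_less_iff)
    then have "y (int (nat (i mod int d))) = y' (int (nat (i mod int d)))"
      using *(3) by (metis (mono_tags, lifting) atLeastLessThan_iff atLeastLessThan_upt map_eq_conv zero_le)
    then show "y i = y' i" using mod[OF *(1), of i] mod[OF *(2), of i] by metis
  qed
  moreover have "finite ((\<lambda>y. map (\<lambda>s. y (int s)) [0..<d]) ` X)"
    by (rule finite_subset[OF _ finite_lists_length_eq[of UNIV d]]) auto
  ultimately show ?thesis by (rule finite_imageD[rotated])
qed

text \<open>A word that starts inside one block and is no longer than the next one ends with it at
  the latest; blocks in front of its start are dropped.\<close>

lemma sublist_two_blocks:
  assumes "w \<noteq> []" "\<And>b. length w \<le> length (W b)"
  shows "sublist w (subst_word W u) \<Longrightarrow> \<exists>v. sublist v u \<and> length v \<le> 2 \<and> sublist w (subst_word W v)"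
proof (induction u)
  case (Cons c u)
  obtain p s where ps: "p @ w @ s = W c @ subst_word W u" using Cons.prems by (auto simp: sublist_def)
  show ?case
  proof (cases "length (W c) \<le> length p")
    case True
    then have "p = W c @ drop (length (W c)) p" using ps
      by (metis append_eq_append_conv_if append_eq_conv_conj)
    then have "sublist w (subst_word W u)" using ps unfolding sublist_def
      by (metis append_assoc same_append_eq)
    then show ?thesis using Cons.IH by (meson sublist_Cons_right)
  next
    case False
    define v where "v = c # take 1 u"
    have "length p + length w \<le> length (subst_word W v) \<or> u = []"
      using assms(2)[of "hd u"] False by (cases u) (auto simp: v_def)
    moreover have v: "subst_word W (c # u) = subst_word W v @ subst_word W (drop 1 u)"
      by (cases u) (auto simp: v_def)
    moreover have "length p + length w \<le> length (subst_word W v)" if "u = []"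
    proof -
      have "length p + length w + length s = length (W c)" using arg_cong[OF ps, of length] that by simp
      then show ?thesis by (simp add: v_def that)
    qed
    ultimately have len: "length p + length w \<le> length (subst_word W v)" by blast
    have "(p @ w) @ s = subst_word W v @ subst_word W (drop 1 u)" using ps v by simp
    then obtain r where "p @ w = subst_word W v @ r \<or> (p @ w) @ r = subst_word W v"
      unfolding append_eq_append_conv2 by blast
    then have "\<exists>r. p @ w @ r = subst_word W v"
    proof
      assume r: "p @ w = subst_word W v @ r"
      from arg_cong[OF this, of length] len have "r = []" by simp
      with r show ?thesis by (intro exI[of _ "[]"]) simp
    qed auto
    then have "sublist w (subst_word W v)" unfolding sublist_def by metis
    moreover have "sublist v (c # u)" unfolding v_def sublist_def
      by (metis append_Cons append_Nil append_take_drop_id)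
    moreover have "length v \<le> 2" by (simp add: v_def)
    ultimately show ?thesis by blast
  qed
qed (use assms in simp)

text \<open>Translating by \<open>D\<close> normalizes an asymptotic pair so that its last
  difference is at \<open>-1\<close>.\<close>

lemma last_difference:
  fixes x y :: "int \<Rightarrow> 'b"
  assumes "x \<noteq> y" "\<And>t. t \<ge> T \<Longrightarrow> x t = y t"
  obtains D where "x (D - 1) \<noteq> y (D - 1)" "\<And>t. t \<ge> D \<Longrightarrow> x t = y t"
proof -
  obtain t0 where t0: "x t0 \<noteq> y t0" using assms(1) by blast
  define n where "n = (LEAST n. \<forall>t\<ge>t0 + int n. x t = y t)"
  have "\<exists>n. \<forall>t\<ge>t0 + int n. x t = y t" using assms(2) by (intro exI[of _ "nat (T - t0)"]) auto
  then have n: "\<forall>t\<ge>t0 + int n. x t = y t" unfolding n_def by (rule LeastI_ex)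
  then have "n \<noteq> 0" using t0 by (intro notI) auto
  then obtain m where m: "n = Suc m" by (cases n) auto
  then have "m < (LEAST n. \<forall>t\<ge>t0 + int n. x t = y t)" by (simp flip: n_def)
  from not_less_Least[OF this] obtain t where t: "t \<ge> t0 + int m" "x t \<noteq> y t" by blast
  moreover have "t < t0 + int n" using n t(2) by (meson not_le)
  ultimately have "t = t0 + int n - 1" using m by simp
  then show thesis using that[of "t0 + int n"] t(2) n by blast
qed

section \<open>Desubstitution\<close>

text \<open>A parse of \<open>z\<close> into blocks \<open>W a\<close> records, for each position \<open>t\<close>, the letter \<open>a\<close> of the block
  containing it and the index of \<open>t\<close> within this block; \<open>reads W g A v\<close> says that \<open>A\<close> is a cut
  followed by the blocks of the letters of \<open>v\<close>.\<close>

definition parse :: "('a \<Rightarrow> 'a list) \<Rightarrow> (int \<Rightarrow> 'a) \<Rightarrow> (int \<Rightarrow> 'a \<times> nat) \<Rightarrow> bool" where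
  "parse W z g \<longleftrightarrow> (\<forall>t. snd (g t) < length (W (fst (g t))) \<and> z t = W (fst (g t)) ! snd (g t) \<and>
     (if Suc (snd (g t)) < length (W (fst (g t))) then g (t + 1) = (fst (g t), Suc (snd (g t)))
      else snd (g (t + 1)) = 0))"

fun reads :: "('a \<Rightarrow> 'a list) \<Rightarrow> (int \<Rightarrow> 'a \<times> nat) \<Rightarrow> int \<Rightarrow> 'a list \<Rightarrow> bool" where
  "reads W g A [] \<longleftrightarrow> True"
| "reads W g A (a # v) \<longleftrightarrow> g A = (a, 0) \<and> reads W g (A + int (length (W a))) v"

lemma reads_append:
  "reads W g A (u @ v) \<longleftrightarrow> reads W g A u \<and> reads W g (A + int (length (subst_word W u))) v"
  by (induction u arbitrary: A) (auto simp: add.assoc)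

lemma parse_block:
  assumes "parse W z g" "g t = (a, 0)"
  shows "j < length (W a) \<Longrightarrow> g (t + int j) = (a, j)"
proof (induction j)
  case (Suc j)
  then have "g (t + int j) = (a, j)" by simp
  then show ?case using assms(1)[unfolded parse_def, rule_format, of "t + int j"] Suc.prems
    by (simp add: algebra_simps)
qed (use assms in simp)

lemma parse_next:
  assumes "parse W z g" "g t = (a, j)"
  shows "snd (g (t + int (length (W a) - j))) = 0"
proof -
  have j: "j < length (W a)" using assms unfolding parse_def by (metis fst_conv snd_conv)
  have *: "i \<le> length (W a) - 1 - j \<Longrightarrow> g (t + int i) = (a, j + i)" for i
  proof (induction i)
    case (Suc i)
    then have "g (t + int i) = (a, j + i)" by simp
    then show ?case using assms(1)[unfolded parse_def, rule_format, of "t + int i"] Suc.prems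
      by (simp add: algebra_simps split: if_splits)
  qed (use assms in simp)
  define i where "i = length (W a) - 1 - j"
  have "g (t + int i) = (a, length (W a) - 1)" using *[of i] j by (simp add: i_def)
  then have "snd (g (t + int i + 1)) = 0"
    using assms(1)[unfolded parse_def, rule_format, of "t + int i"] j by (simp split: if_splits)
  moreover have "t + int (length (W a) - j) = t + int i + 1" using j by (simp add: i_def of_nat_diff)
  ultimately show ?thesis by metis
qed

lemma parse_cut:
  assumes "parse W z g" "\<And>a. length (W a) \<le> M"
  obtains A where "t \<le> A" "A \<le> t + int M" "snd (g A) = 0"
proof -
  obtain a j where g: "g t = (a, j)" by fastforce
  show thesis
    by (rule that[of "t + int (length (W a) - j)"])
      (use parse_next[OF assms(1) g] assms(2)[of a] in auto)
qed

lemma parse_reads: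
  assumes "parse W z g"
  shows "snd (g A) = 0 \<Longrightarrow> \<exists>v. length v = K \<and> reads W g A v"
proof (induction K arbitrary: A)
  case (Suc K)
  define a where "a = fst (g A)"
  have g: "g A = (a, 0)" using Suc.prems by (simp add: a_def prod_eq_iff)
  from parse_next[OF assms g] Suc.IH obtain v where
    "length v = K" "reads W g (A + int (length (W a))) v" by auto
  then show ?case using g by (intro exI[of _ "a # v"]) simp
qed simp

lemma reads_nth:
  assumes "parse W z g"
  shows "reads W g A v \<Longrightarrow> i < length (subst_word W v) \<Longrightarrow> z (A + int i) = subst_word W v ! i"
proof (induction v arbitrary: A i)
  case (Cons a v)
  show ?case
  proof (cases "i < length (W a)")
    case True
    then have "g (A + int i) = (a, i)" using parse_block[OF assms] Cons.prems by simp
    then show ?thesis using True assms[unfolded parse_def, rule_format, of "A + int i"]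
      by (simp add: nth_append)
  next
    case False
    then show ?thesis using Cons.IH[of "A + int (length (W a))" "i - length (W a)"] Cons.prems
      by (simp add: nth_append)
  qed
qed simp

text \<open>The finite counterpart of a parse. The value \<open>undefined\<close> stands for
  positions beyond the end of the word.\<close>

fun locate :: "('a \<Rightarrow> 'a list) \<Rightarrow> 'a list \<Rightarrow> nat \<Rightarrow> 'a \<times> nat" where
  "locate W [] j = undefined"
| "locate W (a # u) j = (if j < length (W a) then (a, j) else locate W u (j - length (W a)))"

lemma locate_0: "(\<And>a. W a \<noteq> []) \<Longrightarrow> u \<noteq> [] \<Longrightarrow> locate W u 0 = (hd u, 0)"
  by (cases u) auto

text \<open>These are the local conditions of \<open>parse\<close>, together with the fact that the
  last block ends exactly with the word, which is needed to join located words at the cuts of a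
  coarser parse.\<close>

lemma locate_correct:
  assumes W: "\<And>a. W a \<noteq> []"
  shows "j < length (subst_word W u) \<Longrightarrow> locate W u j = (b, i) \<Longrightarrow>
    i < length (W b) \<and> subst_word W u ! j = W b ! i \<and>
    (if Suc j < length (subst_word W u)
     then if Suc i < length (W b) then locate W u (Suc j) = (b, Suc i) else snd (locate W u (Suc j)) = 0
     else Suc i = length (W b))"
proof (induction u arbitrary: j)
  case (Cons a u)
  show ?case
  proof (cases "j < length (W a)")
    case True
    show ?thesis
    proof (cases "u = []")
      case u: False
      then show ?thesis using Cons.prems True locate_0[of W u] W
        by (cases u) (auto simp: nth_append not_less_eq less_Suc_eq)
    qed (use Cons.prems True in auto)
  next
    case False
    then show ?thesis using Cons.prems Cons.IH[of "j - length (W a)"]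
      by (auto simp: nth_append Suc_diff_le not_less split: if_splits)
  qed
qed simp

lemma reads_locate:
  assumes W: "\<And>a. W a \<noteq> []"
  shows "(\<And>j. j < length (subst_word W u) \<Longrightarrow> g (A + int j) = locate W u j) \<Longrightarrow> reads W g A u"
proof (induction u arbitrary: A)
  case (Cons a u)
  have "reads W g (A + int (length (W a))) u"
  proof (rule Cons.IH)
    fix j assume "j < length (subst_word W u)"
    then show "g (A + int (length (W a)) + int j) = locate W u j"
      using Cons.prems[of "length (W a) + j"] by (simp add: add.assoc)
  qed
  then show ?case using Cons.prems[of 0] W[of a] by simp
qed simp

text \<open>Each block \<open>subst_word W (U a)\<close> is a concatenation of
  \<open>W\<close>-blocks, so locating positions inside it refines the parse and keeps the old cuts.
  This leads from level \<open>p + q\<close> to level \<open>p\<close>.\<close>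

lemma parse_refine:
  fixes W U :: "'a \<Rightarrow> 'a list" and z :: "int \<Rightarrow> 'a"
  assumes W: "\<And>a. W a \<noteq> []" and U: "\<And>a. U a \<noteq> []"
    and g: "parse (\<lambda>a. subst_word W (U a)) z g"
  obtains g' where "parse W z g'"
    "\<And>A v. reads (\<lambda>a. subst_word W (U a)) g A v \<Longrightarrow> reads W g' A (subst_word U v)"
proof -
  define g' where "g' t = locate W (U (fst (g t))) (snd (g t))" for t
  have "parse W z g'"
    unfolding parse_def
  proof
    fix t
    obtain a j where gt: "g t = (a, j)" by fastforce
    obtain b i where bi: "locate W (U a) j = (b, i)" by fastforce
    note P = g[unfolded parse_def, rule_format, of t, unfolded gt, simplified]
    note L = locate_correct[of W j "U a" b i, OF assms(1)]
    obtain a' where a': "g (t + 1) = (a', snd (g (t + 1)))" by (metis prod.collapse)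
    show "snd (g' t) < length (W (fst (g' t))) \<and> z t = W (fst (g' t)) ! snd (g' t) \<and>
     (if Suc (snd (g' t)) < length (W (fst (g' t))) then g' (t + 1) = (fst (g' t), Suc (snd (g' t)))
      else snd (g' (t + 1)) = 0)"
      using P L bi gt a' locate_0[of W "U (fst (g (t + 1)))"] W U unfolding g'_def
      by (auto split: if_splits)
  qed
  moreover have "reads W g' A (subst_word U v)"
    if "reads (\<lambda>a. subst_word W (U a)) g A v" for A v
    using that
  proof (induction v arbitrary: A)
    case (Cons a v)
    have "reads W g' A (U a)"
    proof (rule reads_locate[of W, OF assms(1)])
      fix j assume "j < length (subst_word W (U a))"
      then have "g (A + int j) = (a, j)" using parse_block[OF g] Cons.prems by simp
      then show "g' (A + int j) = locate W (U a) j" by (simp add: g'_def)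
    qed
    then show ?case using Cons by (simp add: reads_append)
  qed simp
  ultimately show thesis by (rule that)
qed

section \<open>Folding of labelled graphs\<close>

definition relabel :: "('v \<Rightarrow> 'u) \<Rightarrow> 'v \<times> 'b \<times> 'v \<Rightarrow> 'u \<times> 'b \<times> 'u" where
  "relabel f e = (f (fst e), fst (snd e), f (snd (snd e)))"

lemma relabel_simp [simp]: "relabel f (P, \<alpha>, Q) = (f P, \<alpha>, f Q)"
  by (simp add: relabel_def)

lemma relabel_comp: "relabel (g \<circ> f) = relabel g \<circ> relabel f"
  by (simp add: relabel_def fun_eq_iff)

definition codeterministic :: "('v \<times> 'b \<times> 'v) set \<Rightarrow> bool" where
  "codeterministic E \<longleftrightarrow> (\<forall>P P' \<alpha> Q. (P, \<alpha>, Q) \<in> E \<longrightarrow> (P', \<alpha>, Q) \<in> E \<longrightarrow> P = P')"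

text \<open>Stallings folding: merging the sources of two equally labelled edges into the same vertex
  destroys one vertex and at least one edge, so \<open>card E - card V\<close> does not increase.\<close>

lemma folding:
  fixes E :: "('v \<times> 'b \<times> 'v) set" and F :: "'v \<Rightarrow> 'w"
  assumes "finite V" "E \<subseteq> V \<times> UNIV \<times> V" "finite E"
    and "\<And>P \<alpha> Q. (P, \<alpha>, Q) \<in> E \<Longrightarrow> F P = G \<alpha> (F Q)"
  shows "\<exists>f :: 'v \<Rightarrow> 'v. codeterministic (relabel f ` E) \<and>
    (\<forall>P\<in>V. \<forall>Q\<in>V. f P = f Q \<longrightarrow> F P = F Q) \<and>
    card (relabel f ` E) + card V \<le> card E + card (f ` V)"
  using assms
proof (induction "card V" arbitrary: V E rule: less_induct)
  case less
  show ?case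
  proof (cases "codeterministic E")
    case True
    have "relabel id ` E = E" by (force simp: relabel_def)
    then show ?thesis using True by (intro exI[of _ id]) auto
  next
    case False
    then obtain P P' \<alpha> Q where e: "(P, \<alpha>, Q) \<in> E" "(P', \<alpha>, Q) \<in> E" "P \<noteq> P'"
      unfolding codeterministic_def by blast
    then have V: "P \<in> V" "P' \<in> V" "Q \<in> V" using less.prems(2) by auto
    \<comment> \<open>Both sources have the value \<open>G \<alpha> (F Q)\<close>, so
      \<open>F\<close> never separates merged vertices and stays well defined on the
      quotient.\<close>
    have FP: "F P = F P'" using e less.prems(4) by metis
    define g where "g = id(P := P')"
    define V1 E1 where "V1 = V - {P}" and "E1 = relabel g ` E"
    have gV: "g ` V = V1" using V e(3) by (auto simp: g_def V1_def)
    have Fg: "F (g R) = F R" for R using FP by (simp add: g_def)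
    have cardV: "card V = Suc (card V1)" using card_Suc_Diff1[OF less.prems(1) V(1)] by (simp add: V1_def)
    have "E1 = relabel g ` (E - {(P, \<alpha>, Q)})"
    proof -
      have "relabel g (P, \<alpha>, Q) = relabel g (P', \<alpha>, Q)" using e(3) by (simp add: g_def)
      moreover have "(P', \<alpha>, Q) \<in> E - {(P, \<alpha>, Q)}" using e by simp
      ultimately have "relabel g (P, \<alpha>, Q) \<in> relabel g ` (E - {(P, \<alpha>, Q)})" by (metis image_eqI)
      then show ?thesis unfolding E1_def by blast
    qed
    then have "card E1 \<le> card (E - {(P, \<alpha>, Q)})" using less.prems(3) by (simp add: card_image_le)
    then have cardE: "Suc (card E1) \<le> card E" using e(1) less.prems(3)
      by (metis Suc_le_mono card_Suc_Diff1)
    have "\<exists>f :: 'v \<Rightarrow> 'v. codeterministic (relabel f ` E1) \<and>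
      (\<forall>P\<in>V1. \<forall>Q\<in>V1. f P = f Q \<longrightarrow> F P = F Q) \<and>
      card (relabel f ` E1) + card V1 \<le> card E1 + card (f ` V1)"
    proof (rule less.hyps)
      show "card V1 < card V" using cardV by simp
      show "finite V1" "finite E1" using less.prems by (auto simp: V1_def E1_def)
      show "E1 \<subseteq> V1 \<times> UNIV \<times> V1"
        using less.prems(2) gV by (force simp: E1_def relabel_def)
      show "F R = G \<beta> (F S)" if "(R, \<beta>, S) \<in> E1" for R \<beta> S
        using that less.prems(4) by (auto simp: E1_def relabel_def Fg)
    qed
    then obtain f :: "'v \<Rightarrow> 'v" where f: "codeterministic (relabel f ` E1)"
      "\<And>P Q. P \<in> V1 \<Longrightarrow> Q \<in> V1 \<Longrightarrow> f P = f Q \<Longrightarrow> F P = F Q"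
      "card (relabel f ` E1) + card V1 \<le> card E1 + card (f ` V1)" by blast
    have im: "relabel (f \<circ> g) ` E = relabel f ` E1" "(f \<circ> g) ` V = f ` V1"
      by (simp_all add: relabel_comp E1_def image_comp flip: gV)
    have "\<forall>R\<in>V. \<forall>S\<in>V. (f \<circ> g) R = (f \<circ> g) S \<longrightarrow> F R = F S"
    proof (intro ballI impI)
      fix R S assume "R \<in> V" "S \<in> V" "(f \<circ> g) R = (f \<circ> g) S"
      then show "F R = F S" using f(2)[of "g R" "g S"] gV by (metis Fg comp_apply imageI)
    qed
    moreover have "card (relabel f ` E1) + card V \<le> card E + card (f ` V1)"
      using f(3) cardV cardE by linarith
    ultimately show ?thesis unfolding im[symmetric] using f(1) im by metis
  qed
qed

text \<open>Different labels are what the last difference of an asymptotic pair provides. In a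
  codeterministic graph these are exactly the vertices with at least two incoming edges.\<close>

definition branch_vertices :: "('v \<times> 'b \<times> 'v) set \<Rightarrow> 'v set" where
  "branch_vertices E = {Q. \<exists>P P' \<alpha> \<beta>. \<alpha> \<noteq> \<beta> \<and> (P, \<alpha>, Q) \<in> E \<and> (P', \<beta>, Q) \<in> E}"

text \<open>Edges are counted by their targets: every vertex of \<open>V\<close> receives at least
  one, a branch vertex at least two.\<close>

lemma card_branch_vertices:
  assumes "finite E" "finite V" "\<And>Q. Q \<in> V \<Longrightarrow> \<exists>P \<alpha>. (P, \<alpha>, Q) \<in> E"
    "branch_vertices E \<subseteq> V"
  shows "card V + card (branch_vertices E) \<le> card E"
proof -
  define T where "T Q = {e \<in> E. snd (snd e) = Q}" for Q
  have fin: "finite (T Q)" for Q using assms(1) by (simp add: T_def)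
  have ge1: "1 \<le> card (T Q)" if "Q \<in> V" for Q
  proof -
    obtain P \<alpha> where "(P, \<alpha>, Q) \<in> T Q" using assms(3)[OF \<open>Q \<in> V\<close>] unfolding T_def by auto
    then have "T Q \<noteq> {}" by blast
    then show ?thesis using fin[of Q] by (simp add: Suc_leI card_gt_0_iff)
  qed
  have ge2: "2 \<le> card (T Q)" if Q: "Q \<in> branch_vertices E" for Q
  proof -
    obtain P P' \<alpha> \<beta> where e: "\<alpha> \<noteq> \<beta>" "(P, \<alpha>, Q) \<in> T Q" "(P', \<beta>, Q) \<in> T Q"
      using Q by (auto simp: branch_vertices_def T_def)
    have "card {(P, \<alpha>, Q), (P', \<beta>, Q)} \<le> card (T Q)" by (rule card_mono[OF fin]) (use e in auto)
    then show ?thesis using e(1) by simp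
  qed
  have "card (branch_vertices E) = (\<Sum>Q\<in>V. if Q \<in> branch_vertices E then 1 else 0)"
    using assms(2,4) by (simp add: sum.If_cases Int_absorb1)
  then have "card V + card (branch_vertices E) = (\<Sum>Q\<in>V. 1 + (if Q \<in> branch_vertices E then 1 else 0))"
    by (simp only: sum.distrib card_eq_sum)
  also have "\<dots> \<le> (\<Sum>Q\<in>V. card (T Q))" by (rule sum_mono) (use ge1 ge2 in fastforce)
  also have "\<dots> = card (\<Union>Q\<in>V. T Q)"
    by (rule card_UN_disjoint[symmetric]) (use assms(2) fin in \<open>auto simp: T_def\<close>)
  also have "\<dots> \<le> card E" by (rule card_mono) (use assms(1) in \<open>auto simp: T_def\<close>)
  finally show ?thesis .
qed

text \<open>The graph whose vertices are the letters, with a path labelled \<open>W y\<close> from \<open>y\<close> to \<open>x\<close>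
  for all \<open>x\<close>, \<open>y\<close>. The interior vertices of this path are \<open>(y, x, j)\<close> with \<open>j > 0\<close>, and the
  letter \<open>y\<close> is the vertex \<open>(y, y, 0)\<close>.\<close>

definition vertex :: "'a \<Rightarrow> 'a \<Rightarrow> nat \<Rightarrow> 'a \<times> 'a \<times> nat" where
  "vertex y x j = (if j = 0 then (y, y, 0) else (y, x, j))"

definition graph_vertices :: "('a \<Rightarrow> 'a list) \<Rightarrow> ('a \<times> 'a \<times> nat) set" where
  "graph_vertices W = {vertex y x j | y x j. j < length (W y)}"

definition graph_edges ::
    "('a \<Rightarrow> 'a list) \<Rightarrow> (('a \<times> 'a \<times> nat) \<times> 'a \<times> ('a \<times> 'a \<times> nat)) set" where
  "graph_edges W = (\<lambda>(y, x, j). (vertex y x j, W y ! j,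
     if Suc j < length (W y) then vertex y x (Suc j) else vertex x x 0)) `
     {(y, x, j). j < length (W y)}"

lemma finite_graph:
  fixes W :: "'a::finite \<Rightarrow> 'a list"
  shows "finite {(y :: 'a, x :: 'a, j). j < length (W y)}" "finite (graph_vertices W)" "finite (graph_edges W)"
proof -
  have "{(y :: 'a, x :: 'a, j). j < length (W y)} = (SIGMA y:UNIV. UNIV \<times> {..<length (W y)})" by auto
  then show S: "finite {(y :: 'a, x :: 'a, j). j < length (W y)}" by simp
  have "graph_vertices W = (\<lambda>(y, x, j). vertex y x j) ` {(y, x, j). j < length (W y)}"
    by (force simp: graph_vertices_def)
  with S show "finite (graph_vertices W)" by simp
  show "finite (graph_edges W)" unfolding graph_edges_def by (rule finite_imageI[OF S])
qed

text \<open>A triple \<open>(y, x, j)\<close> indexes the edge at position \<open>j\<close> of the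
  path from \<open>y\<close> to \<open>x\<close>. Triples with \<open>j > 0\<close> are interior
  vertices, which leaves the k^2 initial edges with \<open>j = 0\<close>.\<close>

lemma card_graph:
  fixes W :: "'a::finite \<Rightarrow> 'a list"
  shows "card (graph_edges W) \<le> card (graph_vertices W) + CARD('a)\<^sup>2"
proof -
  let ?S = "{(y :: 'a, x :: 'a, j). j < length (W y)}"
  let ?S' = "{(y :: 'a, x :: 'a, j). 0 < j \<and> j < length (W y)}"
  have "?S' \<subseteq> graph_vertices W" by (force simp: graph_vertices_def vertex_def)
  then have S': "card ?S' \<le> card (graph_vertices W)" by (rule card_mono[OF finite_graph(2)])
  have "card (graph_edges W) \<le> card ?S"
    unfolding graph_edges_def by (rule card_image_le[OF finite_graph(1)])
  also have "\<dots> \<le> card (?S' \<union> (\<lambda>(y, x). (y, x, 0)) ` UNIV)"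
  proof (rule card_mono)
    show "finite (?S' \<union> (\<lambda>(y, x). (y, x, 0)) ` UNIV)"
      by (rule finite_UnI[OF finite_subset[OF _ finite_graph(1)[of W]]]) auto
    show "?S \<subseteq> ?S' \<union> (\<lambda>(y, x). (y, x, 0)) ` UNIV" by (force simp: image_iff)
  qed
  also have "\<dots> \<le> card ?S' + card ((\<lambda>(y :: 'a, x :: 'a). (y, x, 0 :: nat)) ` UNIV)" by (rule card_Un_le)
  also have "card ((\<lambda>(y :: 'a, x :: 'a). (y, x, 0 :: nat)) ` UNIV) \<le> CARD('a \<times> 'a)"
    by (rule card_image_le) simp
  also have "CARD('a \<times> 'a) = CARD('a)\<^sup>2" by (simp add: power2_eq_square)
  finally show ?thesis using S' by simp
qed

text \<open>Turns a parse into a walk in the graph. Inside a block the vertex also depends on where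
  the current path ends, so the letter of the following block is looked up at the next cut.\<close>

definition parse_vertex ::
    "('a \<Rightarrow> 'a list) \<Rightarrow> (int \<Rightarrow> 'a \<times> nat) \<Rightarrow> int \<Rightarrow> 'a \<times> 'a \<times> nat" where
  "parse_vertex W g t = (let (y, j) = g t in vertex y (fst (g (t + int (length (W y) - j)))) j)"

lemma parse_vertex_edge:
  assumes "parse W z g"
  shows "(parse_vertex W g t, z t, parse_vertex W g (t + 1)) \<in> graph_edges W"
proof -
  obtain y j where gt: "g t = (y, j)" by fastforce
  note P = assms[unfolded parse_def, rule_format, of t, unfolded gt, simplified]
  define x where "x = fst (g (t + int (length (W y) - j)))"
  have "parse_vertex W g (t + 1) = (if Suc j < length (W y) then vertex y x (Suc j) else vertex x x 0)"
  proof (cases "Suc j < length (W y)")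
    case True
    then have "t + 1 + int (length (W y) - Suc j) = t + int (length (W y) - j)" by simp
    then show ?thesis using True P by (simp add: parse_vertex_def x_def)
  next
    case False
    then have l: "length (W y) - j = 1" using P by linarith
    then have "g (t + 1) = (x, 0)" using False P by (simp add: x_def prod_eq_iff)
    then show ?thesis using False by (simp add: parse_vertex_def vertex_def)
  qed
  then show ?thesis using P gt unfolding graph_edges_def parse_vertex_def x_def
    by (intro image_eqI[of _ _ "(y, x, j)"]) (auto simp: x_def)
qed

text \<open>The word of length \<open>n \<le> min \<bar>W a\<bar>\<close> read by every path from a vertex: the next letter is known
  inside a block, and branching only occurs at the letter vertices.\<close>

definition forward :: "('a \<Rightarrow> 'a list) \<Rightarrow> nat \<Rightarrow> 'a \<times> 'a \<times> nat \<Rightarrow> 'a list" where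
  "forward W n P = (case P of (y, x, j) \<Rightarrow> take n (drop j (W y) @ W x))"

lemma forward_vertex:
  assumes "n \<le> length (W y)"
  shows "forward W n (vertex y x j) = take n (drop j (W y) @ W x)"
  using assms by (simp add: forward_def vertex_def)

text \<open>This is the hypothesis of \<open>folding\<close> for \<open>F = forward W n\<close>,
  with \<open>G\<close> prepending the label and truncating to length \<open>n\<close>. At a letter
  vertex \<open>x\<close> the bound on \<open>n\<close> lets \<open>W x\<close> alone supply the
  word.\<close>

lemma forward_edge:
  assumes n: "\<And>a. n \<le> length (W a)" and e: "(P, \<alpha>, Q) \<in> graph_edges W"
  shows "forward W n P = take n (\<alpha> # forward W n Q)"
proof -
  from e obtain y x j where j: "j < length (W y)" and P: "P = vertex y x j" and a: "\<alpha> = W y ! j"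
    and Q: "Q = (if Suc j < length (W y) then vertex y x (Suc j) else vertex x x 0)"
    unfolding graph_edges_def by force
  have "forward W n Q = take n (drop (Suc j) (W y) @ W x)"
  proof (cases "Suc j < length (W y)")
    case False
    then have "Suc j = length (W y)" using j by simp
    then show ?thesis using n[of x] by (simp add: Q forward_vertex)
  qed (simp add: Q forward_vertex n)
  moreover have "take n (\<alpha> # take n r) = take n (\<alpha> # r)" for r
    by (cases n) simp_all
  moreover have "drop j (W y) = \<alpha> # drop (Suc j) (W y)" using j a by (simp add: Cons_nth_drop_Suc)
  ultimately show ?thesis using n[of y] by (simp only: P forward_vertex append_Cons)
qed

lemma graph_edges_subset:
  assumes "\<And>a. W a \<noteq> []"
  shows "graph_edges W \<subseteq> graph_vertices W \<times> UNIV \<times> graph_vertices W"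
  using assms by (force simp: graph_edges_def graph_vertices_def)

lemma graph_vertex_target:
  assumes W: "\<And>a. W a \<noteq> []" and Q: "Q \<in> graph_vertices W"
  shows "\<exists>P \<alpha>. (P, \<alpha>, Q) \<in> graph_edges W"
proof -
  obtain y x j where j: "j < length (W y)" and Q: "Q = vertex y x j" using Q by (auto simp: graph_vertices_def)
  show ?thesis
  proof (cases j)
    case 0
    \<comment> \<open>The letter vertex \<open>y\<close> is reached by the last edge of the path
      from \<open>y\<close> to itself.\<close>
    define i where "i = length (W y) - 1"
    have "i < length (W y)" "\<not> Suc i < length (W y)" using W[of y] by (auto simp: i_def)
    then have "(vertex y y i, W y ! i, Q) \<in> graph_edges W" unfolding graph_edges_def
      by (intro image_eqI[of _ _ "(y, y, i)"]) (auto simp: Q 0 vertex_def)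
    then show ?thesis by blast
  next
    case (Suc i)
    then have "(vertex y x i, W y ! i, Q) \<in> graph_edges W" unfolding graph_edges_def using j
      by (intro image_eqI[of _ _ "(y, x, i)"]) (auto simp: Q)
    then show ?thesis by blast
  qed
qed

lemma forward_parse:
  assumes n: "\<And>a. n \<le> length (W a)" and g: "parse W z g"
  shows "forward W n (parse_vertex W g t) = map (\<lambda>i. z (t + int i)) [0..<n]"
proof -
  have step: "forward W n (parse_vertex W g t) = take n (z t # forward W n (parse_vertex W g (t + 1)))" for t
    by (rule forward_edge[OF n parse_vertex_edge[OF g]])
  have "m \<le> n \<Longrightarrow> take m (forward W n (parse_vertex W g t)) = map (\<lambda>i. z (t + int i)) [0..<m]" for m
  proof (induction m arbitrary: t)
    case (Suc m)
    then show ?case by (subst step) (simp add: min_def map_upt_Suc algebra_simps del: upt_Suc)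
  qed simp
  moreover have "take n (forward W n (parse_vertex W g t)) = forward W n (parse_vertex W g t)"
    using step[of t] by (metis take_take min.idem)
  ultimately show ?thesis by (metis order_refl)
qed

text \<open>\<open>f\<close> is the folding map. Two walks that meet at a cut in the common tail
  agree back to position \<open>0\<close> by codeterminism, and the different letters at
  \<open>-1\<close> make the vertex there a branch vertex. Folding respects
  \<open>forward W n\<close>, so this vertex still determines \<open>n\<close> letters.\<close>

lemma branch_classes:
  fixes W :: "'a::finite \<Rightarrow> 'a list"
  assumes W: "\<And>a. W a \<noteq> []" and n: "\<And>a. n \<le> length (W a)"
  obtains B :: "('a \<times> 'a \<times> nat) set" and f where "finite B" "card B \<le> CARD('a)\<^sup>2"
    "\<And>z w g h s a. parse W z g \<Longrightarrow> parse W w h \<Longrightarrow> (\<And>t. t \<ge> 0 \<Longrightarrow> z t = w t) \<Longrightarrow>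
       z (-1) \<noteq> w (-1) \<Longrightarrow> s \<ge> 0 \<Longrightarrow> g s = (a, 0) \<Longrightarrow> h s = (a, 0) \<Longrightarrow> f (parse_vertex W g 0) \<in> B"
    "\<And>z z' g g' i. parse W z g \<Longrightarrow> parse W z' g' \<Longrightarrow>
       f (parse_vertex W g 0) = f (parse_vertex W g' 0) \<Longrightarrow> i < n \<Longrightarrow> z (int i) = z' (int i)"
proof -
  define E V where "E = graph_edges W" and "V = graph_vertices W"
  have fin: "finite V" "finite E" by (simp_all add: E_def V_def finite_graph)
  have EV: "E \<subseteq> V \<times> UNIV \<times> V" unfolding E_def V_def by (rule graph_edges_subset[OF assms(1)])
  obtain f :: "'a \<times> 'a \<times> nat \<Rightarrow> 'a \<times> 'a \<times> nat" where f: "codeterministic (relabel f ` E)"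
    "\<And>P Q. P \<in> V \<Longrightarrow> Q \<in> V \<Longrightarrow> f P = f Q \<Longrightarrow> forward W n P = forward W n Q"
    "card (relabel f ` E) + card V \<le> card E + card (f ` V)"
    using folding[OF fin(1) EV fin(2), of "forward W n" "\<lambda>\<alpha> w. take n (\<alpha> # w)"]
      forward_edge[of n W, OF n] unfolding E_def by blast
  define B where "B = branch_vertices (relabel f ` E)"
  have BV: "B \<subseteq> f ` V" using EV by (force simp: B_def branch_vertices_def relabel_def)
  have "card (f ` V) + card B \<le> card (relabel f ` E)"
    unfolding B_def
  proof (rule card_branch_vertices)
    show "\<exists>P \<alpha>. (P, \<alpha>, Q) \<in> relabel f ` E" if "Q \<in> f ` V" for Q
    proof -
      obtain R where R: "R \<in> V" "Q = f R" using \<open>Q \<in> f ` V\<close> by blast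
      then obtain P \<alpha> where "(P, \<alpha>, R) \<in> E"
        using graph_vertex_target[of W R, OF assms(1)] by (auto simp: E_def V_def)
      then have "relabel f (P, \<alpha>, R) \<in> relabel f ` E" by blast
      then show ?thesis unfolding relabel_simp R(2) by blast
    qed
    show "finite (relabel f ` E)" "finite (f ` V)" using fin finite_imageI by blast+
    show "branch_vertices (relabel f ` E) \<subseteq> f ` V" using BV by (simp only: B_def)
  qed
  \<comment> \<open>The excess of edges over vertices bounds the number of branch vertices; it is at
    most k^2 before folding and does not grow.\<close>
  then have card_B: "card B \<le> CARD('a)\<^sup>2"
    using f(3) card_graph[of W] by (simp add: E_def V_def)
  have edge: "(f (parse_vertex W g t), z t, f (parse_vertex W g (t + 1))) \<in> relabel f ` E"
    if "parse W z g" for z g t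
    using imageI[OF parse_vertex_edge[OF that, of t], of "relabel f"] by (simp add: E_def)
  show thesis
  proof (rule that[of B f])
    show "finite B" using BV fin(1) finite_surj by blast
    show "card B \<le> CARD('a)\<^sup>2" by (fact card_B)
  next
    fix z w g h s a
    assume g: "parse W z g" and h: "parse W w h" and zw: "\<And>t. t \<ge> 0 \<Longrightarrow> z t = w t"
      and diff: "z (-1) \<noteq> w (-1)" and s: "s \<ge> 0" and a: "g s = (a, 0)" "h s = (a, 0)"
    \<comment> \<open>At a cut \<open>parse_vertex\<close> depends only on the letter
      \<open>a\<close>, so both walks are at the same vertex at \<open>s\<close>; equal labels and
      equal targets then force equal sources.\<close>
    have "i \<le> nat s \<Longrightarrow> f (parse_vertex W g (s - int i)) = f (parse_vertex W h (s - int i))" for i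
    proof (induction i)
      case 0
      show ?case using a by (simp add: parse_vertex_def vertex_def)
    next
      case (Suc i)
      define t where "t = s - int (Suc i)"
      have "s - int i = t + 1" "z t = w t" using Suc.prems zw[of t] by (auto simp: t_def)
      then show ?case using Suc edge[OF g, of t] edge[OF h, of t] f(1)
        unfolding codeterministic_def t_def[symmetric] by (metis Suc_leD)
    qed
    from this[of "nat s"] s have "f (parse_vertex W g 0) = f (parse_vertex W h 0)" by simp
    moreover have "(f (parse_vertex W g (-1)), z (-1), f (parse_vertex W g 0)) \<in> relabel f ` E"
      using edge[OF g, of "-1"] by (simp only: add.left_inverse)
    moreover have "(f (parse_vertex W h (-1)), w (-1), f (parse_vertex W h 0)) \<in> relabel f ` E"
      using edge[OF h, of "-1"] by (simp only: add.left_inverse)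
    ultimately show "f (parse_vertex W g 0) \<in> B"
      using diff unfolding B_def branch_vertices_def mem_Collect_eq by metis
  next
    fix z z' g g' i
    assume g: "parse W z g" and g': "parse W z' g'"
      and eq: "f (parse_vertex W g 0) = f (parse_vertex W g' 0)" and i: "i < n"
    have "parse_vertex W g 0 \<in> V" "parse_vertex W g' 0 \<in> V"
      using parse_vertex_edge[OF g, of 0] parse_vertex_edge[OF g', of 0] EV by (auto simp: E_def)
    from f(2)[OF this eq] have "map (\<lambda>i. z (int i)) [0..<n] = map (\<lambda>i. z' (int i)) [0..<n]"
      using forward_parse[of n W, OF n g, of 0] forward_parse[of n W, OF n g', of 0] by simp
    then show "z (int i) = z' (int i)" using i by simp
  qed
qed

section \<open>Linear recurrence\<close>

locale primitive_aperiodic =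
  fixes \<theta> :: "'a::finite \<Rightarrow> 'a list"
  assumes subst: "substitution \<theta>" and prim: "primitive \<theta>" and inf: "infinite (subst_shift \<theta>)"
begin

abbreviation "X \<equiv> subst_shift \<theta>"
abbreviation "it \<equiv> subst_iter \<theta>"

section \<open>Growth of the iterated words\<close>

lemma it_ne: "it q a \<noteq> []" using subst_iter_ne[OF subst] .

lemma length_it_pos: "Suc 0 \<le> length (it q a)" using it_ne[of q a] by (cases "it q a") auto

lemma it_bound: obtains M where "M \<ge> 1" "\<And>a. length (it q a) \<le> M"
proof
  show "Max (range (\<lambda>a. length (it q a))) \<ge> 1"
    by (rule order_trans[OF _ Max_ge[of _ "length (it q undefined)"]]) (use length_it_pos in auto)
qed simp

lemma length_it_mono: "p \<le> q \<Longrightarrow> length (it p a) \<le> length (it q a)"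
proof -
  assume "p \<le> q"
  then have "it q a = subst_word (it (q - p)) (it p a)" using subst_iter_add[of \<theta> "q - p" p a] by simp
  then show ?thesis using length_subst_word_ge[of 1 "it (q - p)" "it p a"] length_it_pos by simp
qed

lemma primitive_exponent: obtains J where "J \<ge> 1" "\<And>a b. b \<in> set (it J a)"
  using prim by (auto simp: primitive_def)

text \<open>For \<open>q > J\<close>, every letter \<open>c\<close> occurs in \<open>it J b\<close>,
  so \<open>it (q - J) c\<close> is at most as long as \<open>it q b\<close>, and
  \<open>it q a\<close> consists of at most \<open>C\<close> such words.\<close>

lemma length_ratio: obtains C where "C \<ge> 1" "\<And>q a b. length (it q a) \<le> C * length (it q b)"
proof -
  obtain J where J: "J \<ge> 1" "\<And>a b. b \<in> set (it J a)" using primitive_exponent by blast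
  obtain C where C: "C \<ge> 1" "\<And>a. length (it J a) \<le> C" using it_bound by blast
  have "length (it q a) \<le> C * length (it q b)" for q a b
  proof (cases "q \<le> J")
    case True
    then have "length (it q a) \<le> C" using length_it_mono[OF True, of a] C(2)[of a] by simp
    also have "\<dots> \<le> C * length (it q b)" using length_it_pos[of q b] by simp
    finally show ?thesis .
  next
    case False
    define l where "l = length (it q b)"
    have "length (it (q - J) c) \<le> l" for c
      using False subst_iter_add[of \<theta> "q - J" J b] length_subst_word_mem[OF J(2)[of c b], of "it (q - J)"]
      by (simp add: l_def)
    then have "length (subst_word (it (q - J)) (it J a)) \<le> l * length (it J a)"
      by (rule length_subst_word_le)
    also have "\<dots> \<le> l * C" using C(2) by simp
    finally show ?thesis using False subst_iter_add[of \<theta> "q - J" J a] by (simp add: l_def mult.commute)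
  qed
  then show thesis using that C(1) by blast
qed

text \<open>An infinite shift needs two letters. Hence \<open>it J a\<close> contains
  \<open>a\<close> and has length at least 2, and every further \<open>J\<close> iterations add a
  letter.\<close>

lemma length_it_growth: obtains q where "\<And>a. n \<le> length (it q a)"
proof -
  obtain J where J: "J \<ge> 1" "\<And>a b. b \<in> set (it J a)" using primitive_exponent by blast
  have "\<exists>a b :: 'a. a \<noteq> b"
  proof (rule ccontr)
    assume "\<not> ?thesis"
    then have "y = (\<lambda>_. undefined)" for y :: "int \<Rightarrow> 'a" by blast
    then have "X \<subseteq> {\<lambda>_. undefined}" by blast
    then show False using inf finite_subset by blast
  qed
  then obtain c d :: 'a where cd: "c \<noteq> d" by blast
  have two: "2 \<le> length (it J a)" for a
  proof -
    have "card {c, d} \<le> card (set (it J a))" by (rule card_mono) (use J in auto)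
    then show ?thesis using cd card_length[of "it J a"] by simp
  qed
  have "n \<le> length (it (J * n) a)" for a
  proof (induction n)
    case (Suc n)
    obtain u1 u2 where u: "it J a = u1 @ a # u2" using J(2)[of a a] by (meson split_list)
    have "1 * length v \<le> length (subst_word (it (J * n)) v)" for v
      by (rule length_subst_word_ge) (use length_it_pos in auto)
    from this[of u1] this[of u2] show ?case
      using Suc two[of a] subst_iter_add[of \<theta> "J * n" J a] by (simp add: u add.commute)
  qed simp
  then show thesis using that by blast
qed

section \<open>Points of the shift and their parses\<close>

lemma translate_mem: "x \<in> X \<Longrightarrow> (\<lambda>i. x (i + n)) \<in> X"
proof -
  assume x: "x \<in> X"
  have "map (\<lambda>i. x (i + n)) [i..j] = map x [i + n..j + n]" for i j
    by (rule nth_equalityI) (auto simp: algebra_simps)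
  then show ?thesis using x by (auto simp: subst_shift_def)
qed

text \<open>The window is enlarged by more letters than any \<open>it q a\<close> has, so it only
  fits into \<open>it m a\<close> with \<open>m > q\<close>.\<close>

lemma window:
  assumes "x \<in> X"
  obtains m a p s where "m \<ge> q" "it m a = p @ map (\<lambda>s. x (i + int s)) [0..<n] @ s"
proof -
  obtain M where M: "M \<ge> 1" "\<And>a. length (it q a) \<le> M" using it_bound by blast
  define n' where "n' = n + Suc M"
  have eq: "map x [i..i + int n' - 1] = map (\<lambda>s. x (i + int s)) [0..<n']"
    by (rule nth_equalityI) auto
  obtain m a where "sublist (map x [i..i + int n' - 1]) (it m a)"
    using assms unfolding subst_shift_def by blast
  then obtain p s where ps: "it m a = p @ map (\<lambda>s. x (i + int s)) [0..<n'] @ s"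
    unfolding eq by (auto simp: sublist_def)
  then have "length (it m a) > M" by (simp add: n'_def)
  then have "\<not> m \<le> q" using length_it_mono[of m q a] M(2)[of a] by auto
  moreover have "[0..<n'] = [0..<n] @ [n..<n']" unfolding n'_def by (metis upt_add_eq_append zero_le)
  ultimately show thesis using that[of m a p "map (\<lambda>s. x (i + int s)) [n..<n'] @ s"] ps by simp
qed

text \<open>Windows of \<open>x\<close> lie in words \<open>it m a\<close> with
  \<open>m \<ge> q\<close>, which are concatenations of blocks \<open>it q b\<close> and are parsed
  by \<open>locate\<close>. A cluster point of these parses is a parse, as the conditions are
  local.\<close>

lemma parse_exists:
  assumes "x \<in> X"
  obtains g where "parse (it q) x g"
proof -
  obtain M where M: "M \<ge> 1" "\<And>a. length (it q a) \<le> M" using it_bound by blast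
  define ok where "ok f t \<longleftrightarrow> snd (f t) < length (it q (fst (f t))) \<and> x t = it q (fst (f t)) ! snd (f t) \<and>
     (if Suc (snd (f t)) < length (it q (fst (f t))) then f (t + 1) = (fst (f t), Suc (snd (f t)))
      else snd (f (t + 1)) = 0)" for f t
  have "\<exists>f. (\<forall>t. f t \<in> UNIV \<times> {..M}) \<and> (\<forall>t. - int N \<le> t \<and> t < int N \<longrightarrow> ok f t)" for N
  proof -
    obtain m a p s where m: "m \<ge> q"
      and "it m a = p @ map (\<lambda>s. x (- int N + int s)) [0..<2 * N + 1] @ s"
      using window[OF assms] by blast
    moreover define u where "u = it (m - q) a"
    moreover have "it m a = subst_word (it q) u"
      using m subst_iter_add[of \<theta> q "m - q" a] by (simp add: u_def)
    ultimately have u: "subst_word (it q) u = p @ map (\<lambda>s. x (- int N + int s)) [0..<2 * N + 1] @ s"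
      by simp
    \<comment> \<open>The default value outside the window keeps \<open>f\<close> within the finite
      set required by \<open>cluster_point\<close>.\<close>
    define f where "f t = (if - int N \<le> t \<and> t \<le> int N then locate (it q) u (length p + nat (t + int N))
      else (undefined, 0))" for t
    have loc: "length p + nat (t + int N) < length (subst_word (it q) u)"
      if "- int N \<le> t \<and> t \<le> int N" for t using that unfolding u by auto
    have "f t \<in> UNIV \<times> {..M}" for t
    proof (cases "- int N \<le> t \<and> t \<le> int N")
      case True
      then show ?thesis using locate_correct[OF it_ne loc[OF True], OF surjective_pairing]
         M(2)[of "fst (f t)"] by (auto simp: f_def mem_Times_iff)
    next
      case False
      then show ?thesis by (auto simp: f_def)
    qed
    moreover have "ok f t" if t: "- int N \<le> t \<and> t < int N" for t
    proof -
      define j where "j = length p + nat (t + int N)"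
      have j: "j < length (subst_word (it q) u)" "Suc j < length (subst_word (it q) u)"
        using loc[of t] loc[of "t + 1"] t by (auto simp: j_def nat_add_distrib)
      have ft: "f t = locate (it q) u j" "f (t + 1) = locate (it q) u (Suc j)"
        using t by (auto simp: f_def j_def nat_add_distrib algebra_simps)
      have "subst_word (it q) u ! j = x t" using t unfolding u j_def by (auto simp: nth_append)
      then show ?thesis using locate_correct[OF it_ne j(1), OF surjective_pairing] j(2)
        unfolding ok_def ft by auto
    qed
    ultimately show ?thesis by blast
  qed
  then obtain f where f: "\<And>N t. f N t \<in> UNIV \<times> {..M}"
    and ok: "\<And>N t. - int N \<le> t \<and> t < int N \<Longrightarrow> ok (f N) t" by metis
  have "finite ((UNIV :: 'a set) \<times> {..M})" by simp
  then obtain g where g: "\<And>N. \<exists>n\<ge>N. \<forall>t\<in>{- int N..int N}. f n t = g t"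
    using cluster_point[of "UNIV \<times> {..M}" f] f by blast
  have "ok g t" for t
  proof -
    obtain n where n: "n \<ge> nat \<bar>t\<bar> + 1" "\<forall>s\<in>{- int (nat \<bar>t\<bar> + 1)..int (nat \<bar>t\<bar> + 1)}. f n s = g s"
      using g by blast
    have "t \<in> {- int (nat \<bar>t\<bar> + 1)..int (nat \<bar>t\<bar> + 1)}" "t + 1 \<in> {- int (nat \<bar>t\<bar> + 1)..int (nat \<bar>t\<bar> + 1)}"
      by auto
    then have "f n t = g t" "f n (t + 1) = g (t + 1)" using n(2) by blast+
    moreover have "ok (f n) t" by (rule ok) (use n in auto)
    ultimately show ?thesis by (auto simp: ok_def split: if_splits)
  qed
  then show thesis using that[of g] by (simp add: parse_def ok_def)
qed

text \<open>There are finitely many such \<open>v\<close>. By primitivity \<open>it m a\<close>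
  occurs in every \<open>it (m + J) c\<close>, and a word that occurs in all \<open>it j c\<close>
  occurs in all later iterates, so a maximum serves as \<open>j0\<close>.\<close>

lemma two_letter_words: obtains j0 where
  "\<And>v m a c. length v \<le> 2 \<Longrightarrow> sublist v (it m a) \<Longrightarrow> sublist v (it j0 c)"
proof -
  obtain J where J: "J \<ge> 1" "\<And>a b. b \<in> set (it J a)" using primitive_exponent by blast
  define L where "L = {v. length v \<le> 2 \<and> (\<exists>m a. sublist v (it m a))}"
  have fin: "finite L"
    by (rule finite_subset[OF _ finite_lists_length_le[of UNIV 2]]) (auto simp: L_def)
  have mono: "sublist v (it j' c)" if "j \<le> j'" "\<And>c. sublist v (it j c)" for j j' v c
  proof -
    obtain d where "d \<in> set (it (j' - j) c)" using it_ne[of "j' - j" c] by (cases "it (j' - j) c") auto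
    then obtain u1 u2 where "it (j' - j) c = u1 @ d # u2" by (meson split_list)
    then have "it j' c = subst_word (it j) u1 @ it j d @ subst_word (it j) u2"
      using subst_iter_add[of \<theta> j "j' - j" c] that(1) by simp
    then have "sublist (it j d) (it j' c)" by (auto simp: sublist_def)
    then show ?thesis using that(2) sublist_order.order.trans by blast
  qed
  have "\<exists>j. \<forall>c. sublist v (it j c)" if v: "v \<in> L" for v
  proof -
    obtain m a where m: "sublist v (it m a)" using v by (auto simp: L_def)
    have "sublist v (it (m + J) c)" for c
    proof -
      obtain u1 u2 where "it J c = u1 @ a # u2" using J(2)[of a c] by (meson split_list)
      then have "sublist (it m a) (it (m + J) c)" by (auto simp: subst_iter_add sublist_def)
      then show ?thesis using m sublist_order.order.trans by blast
    qed
    then show ?thesis by blast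
  qed
  then obtain j where j: "\<And>v c. v \<in> L \<Longrightarrow> sublist v (it (j v) c)" by metis
  have "sublist v (it (Max (j ` L)) c)" if "v \<in> L" for v c
    by (rule mono[of "j v"]) (use that fin j in auto)
  then show thesis by (rule that) (auto simp: L_def)
qed

text \<open>At a level \<open>q\<close> whose blocks are longer than \<open>n\<close>, a word of
  \<open>n + 1\<close> letters meets at most two blocks. The word of their letters occurs in every
  \<open>it j0 c\<close>, so every block of level \<open>q + j0\<close> contains the given
  word.\<close>

lemma linear_recurrence: obtains K where "K \<ge> 1"
  "\<And>n x y t i. n \<ge> 1 \<Longrightarrow> x \<in> X \<Longrightarrow> y \<in> X \<Longrightarrow>
     \<exists>t'. t \<le> t' \<and> t' \<le> t + int (K * n) \<and> (\<forall>s\<le>n. x (t' + int s) = y (i + int s))"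
proof -
  obtain C where C: "C \<ge> 1" "\<And>q a b. length (it q a) \<le> C * length (it q b)" using length_ratio by blast
  obtain j0 where j0: "\<And>v m a c. length v \<le> 2 \<Longrightarrow> sublist v (it m a) \<Longrightarrow> sublist v (it j0 c)"
    using two_letter_words by blast
  obtain M' where M': "M' \<ge> 1" "\<And>a. length (it (Suc j0) a) \<le> M'" using it_bound by blast
  have "\<exists>t'. t \<le> t' \<and> t' \<le> t + int (2 * C * M' * n) \<and> (\<forall>s\<le>n. x (t' + int s) = y (i + int s))"
    if n: "n \<ge> 1" and x: "x \<in> X" and y: "y \<in> X" for n x y t i
  proof -
    define w where "w = map (\<lambda>s. y (i + int s)) [0..<Suc n]"
    define q where "q = (LEAST q. \<forall>a. Suc n \<le> length (it q a))"
    have "\<exists>q. \<forall>a. Suc n \<le> length (it q a)" using length_it_growth by blast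
    then have q: "\<And>a. Suc n \<le> length (it q a)" unfolding q_def by (rule LeastI2_ex) blast
    have "q \<noteq> 0" using q[of undefined] n by (intro notI) (simp add: subst_iter_def)
    then obtain q' where q': "q = Suc q'" by (cases q) auto
    then have "q' < (LEAST q. \<forall>a. Suc n \<le> length (it q a))" by (simp flip: q_def)
    from not_less_Least[OF this] have "\<not> (\<forall>a. Suc n \<le> length (it q' a))" .
    \<comment> \<open>By minimality of \<open>q\<close> some block of level \<open>q - 1\<close> has
      at most \<open>n\<close> letters, hence all have at most \<open>C * n\<close>; the remaining
      \<open>Suc j0\<close> levels cost the factor \<open>M'\<close>.\<close>
    then obtain a where "length (it q' a) \<le> n" by (auto simp: not_le less_Suc_eq_le)
    then have "length (it q' b) \<le> C * n" for b
      using C(2)[of q' b a] by (meson mult_le_mono2 order_trans)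
    then have "length (subst_word (it q') (it (Suc j0) c)) \<le> C * n * length (it (Suc j0) c)" for c
      by (rule length_subst_word_le)
    moreover have "C * n * length (it (Suc j0) c) \<le> C * n * M'" for c using M' by simp
    ultimately have "length (subst_word (it q') (it (Suc j0) c)) \<le> C * n * M'" for c
      using order_trans by blast
    then have len: "length (it (q + j0) c) \<le> C * M' * n" for c
      using subst_iter_add[of \<theta> q' "Suc j0" c] q' by (simp add: ac_simps)
    obtain m a p s where m: "m \<ge> q" and "it m a = p @ w @ s"
      using window[OF y, of q i "Suc n"] unfolding w_def by blast
    then have "sublist w (subst_word (it q) (it (m - q) a))"
      using subst_iter_add[of \<theta> q "m - q" a] unfolding sublist_def by (metis le_add_diff_inverse)
    then obtain v where "sublist v (it (m - q) a)" "length v \<le> 2" and v: "sublist w (subst_word (it q) v)"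
      using sublist_two_blocks[of w "it q" "it (m - q) a"] q by (auto simp: w_def)
    then have "sublist v (it j0 c)" for c using j0 by blast
    then have "sublist w (it (q + j0) c)" for c
      using v sublist_subst_word sublist_order.order.trans unfolding subst_iter_add by blast
    note w = this
    obtain g where g: "parse (it (q + j0)) x g" using parse_exists[OF x] by blast
    obtain A where A: "t \<le> A" "A \<le> t + int (C * M' * n)" "snd (g A) = 0"
      using parse_cut[OF g len] by blast
    then obtain c where c: "reads (it (q + j0)) g A [c]" by (auto simp: prod_eq_iff)
    obtain p s where ps: "it (q + j0) c = p @ w @ s" using w[of c] unfolding sublist_def by blast
    have "x (A + int (length p) + int k) = y (i + int k)" if "k \<le> n" for k
    proof -
      have "x (A + int (length p + k)) = it (q + j0) c ! (length p + k)"
        using reads_nth[OF g c, of "length p + k"] ps that by (simp add: w_def)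
      also have "\<dots> = y (i + int k)" using that by (simp add: ps nth_append w_def del: upt_Suc)
      finally show ?thesis by (simp add: add.assoc)
    qed
    \<comment> \<open>One block length to reach a cut and one for the position inside the block give
      the factor 2.\<close>
    moreover have "A + int (length p) \<le> t + int (2 * C * M' * n)"
    proof -
      have "length p \<le> C * M' * n" using len[of c] ps by simp
      then have "A + int (length p) \<le> t + int (C * M' * n) + int (C * M' * n)"
        using A(2) by (metis add_mono of_nat_mono)
      then show ?thesis by (simp add: mult.assoc)
    qed
    ultimately show ?thesis using A(1) by (intro exI[of _ "A + int (length p)"]) auto
  qed
  moreover have "2 * C * M' \<ge> 1" using C(1) M'(1) by simp
  ultimately show thesis using that by blast
qed

text \<open>A factor of period \<open>d\<close> that is long enough to contain all words of length \<open>d + 1\<close> makes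
  all points periodic.\<close>

lemma no_long_repetition: obtains K where "K \<ge> 1"
  "\<And>x d t. x \<in> X \<Longrightarrow> d \<ge> 1 \<Longrightarrow> \<exists>s. t \<le> s \<and> s \<le> t + int (K * d) \<and> x s \<noteq> x (s + int d)"
proof -
  obtain K where K: "K \<ge> 1" "\<And>n x y t i. n \<ge> 1 \<Longrightarrow> x \<in> X \<Longrightarrow> y \<in> X \<Longrightarrow>
     \<exists>t'. t \<le> t' \<and> t' \<le> t + int (K * n) \<and> (\<forall>s\<le>n. x (t' + int s) = y (i + int s))"
    using linear_recurrence by blast
  have "\<exists>s. t \<le> s \<and> s \<le> t + int (K * d) \<and> x s \<noteq> x (s + int d)" if x: "x \<in> X" and d: "d \<ge> 1" for x d t
  proof (rule ccontr)
    assume *: "\<not> ?thesis"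
    have "y (i + int d) = y i" if y: "y \<in> X" for y i
    proof -
      obtain t' where t': "t \<le> t'" "t' \<le> t + int (K * d)" "\<forall>s\<le>d. x (t' + int s) = y (i + int s)"
        using K(2)[OF d x y] by blast
      then have "x t' = x (t' + int d)" using * by blast
      then show ?thesis using t'(3)[rule_format, of 0] t'(3)[rule_format, of d] by simp
    qed
    then show False using finite_if_periodic[OF d] inf by blast
  qed
  then show thesis using that K(1) by blast
qed

section \<open>Synchronization of asymptotic pairs\<close>

definition min_len :: "nat \<Rightarrow> nat" where "min_len q = Min (range (\<lambda>a. length (it q a)))"

definition max_len :: "nat \<Rightarrow> nat" where "max_len q = Max (range (\<lambda>a. length (it q a)))"

lemma min_len_le: "min_len q \<le> length (it q a)"
  by (simp add: min_len_def)

lemma le_max_len: "length (it q a) \<le> max_len q"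
  by (simp add: max_len_def)

lemma min_len_pos: "1 \<le> min_len q"
  unfolding min_len_def by (subst Min_ge_iff) (use length_it_pos in auto)

lemma max_len_le_min_len: obtains C where "C \<ge> 1" "\<And>q. max_len q \<le> C * min_len q"
proof -
  obtain C where C: "C \<ge> 1" "\<And>q a b. length (it q a) \<le> C * length (it q b)" using length_ratio by blast
  have "max_len q \<le> C * min_len q" for q
  proof -
    have "max_len q \<in> range (\<lambda>a. length (it q a))" "min_len q \<in> range (\<lambda>a. length (it q a))"
      unfolding max_len_def min_len_def by (auto intro!: Max_in Min_in simp del: image_iff)
    then show ?thesis using C(2) by auto
  qed
  then show thesis using that C(1) by blast
qed

text \<open>If the cuts at level \<open>q\<^sub>1\<close> and at level \<open>p + q\<^sub>1\<close> are surrounded by the same letters, then the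
  images under \<open>\<theta>\<^sup>p\<close> of the overlap at level \<open>q\<^sub>1\<close> must be aligned, as otherwise there is a long
  repetition.\<close>

lemma aligned_cut:
  assumes C: "\<And>q. max_len q \<le> C * min_len q"
    and Kr: "\<And>x d t. x \<in> X \<Longrightarrow> d \<ge> 1 \<Longrightarrow> \<exists>s. t \<le> s \<and> s \<le> t + int (Kr * d) \<and> x s \<noteq> x (s + int d)"
    and K': "K' = Kr * (C + 1) * C + 1" and K: "K = C * (K' + 1)"
    and z: "z \<in> X" and zw: "\<And>t. t \<ge> 0 \<Longrightarrow> z t = w t"
    and v: "length v = K" "length v' = K"
    and g1: "parse (it q1) z g1" "reads (it q1) g1 A1 v"
    and h1: "parse (it q1) w h1" "reads (it q1) h1 B1 v'"
    and pos1: "0 \<le> A1" "A1 \<le> B1" "B1 \<le> int (max_len q1)"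
    and g2: "parse (it (p + q1)) z g2" "reads (it (p + q1)) g2 A2 v"
    and h2: "parse (it (p + q1)) w h2" "reads (it (p + q1)) h2 B2 v'"
    and pos2: "0 \<le> A2" "0 \<le> B2" "A2 \<le> int (max_len (p + q1))" "B2 \<le> int (max_len (p + q1))"
  obtains g h s a where "parse (it p) z g" "parse (it p) w h" "s \<ge> 0" "g s = (a, 0)" "h s = (a, 0)"
proof -
  define e where "e = nat (B1 - A1)"
  have e: "B1 = A1 + int e" "e \<le> max_len q1" using pos1 by (auto simp: e_def)
  \<comment> \<open>\<open>u\<close> spans \<open>K'\<close> blocks from the cut \<open>B1\<close>,
    and \<open>pre\<close> fills the gap between the two cuts in \<open>z\<close>.\<close>
  define u where "u = subst_word (it q1) (take K' v')"
  define pre where "pre = take e (subst_word (it q1) v)"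
  have C1: "C \<ge> 1" using C[of 0] min_len_pos[of 0] le_max_len[of 0 undefined] length_it_pos[of 0 undefined]
    by (cases C) auto
  have "K' + 1 \<le> K" using mult_le_mono1[OF C1, of "K' + 1"] unfolding K by simp
  then have K'_K: "K' \<le> K" "C \<le> K" by (auto simp: K)
  have lenu: "length u \<le> max_len q1 * K'"
    unfolding u_def using length_subst_word_le[of "it q1" "max_len q1" "take K' v'"] le_max_len v(2) K'_K
    by simp
  \<comment> \<open>\<open>K\<close> is chosen so that the \<open>K\<close> blocks following
    \<open>A1\<close> cover both the gap and \<open>u\<close>.\<close>
  have "e + length u \<le> max_len q1 * (K' + 1)" using e(2) lenu by simp
  also have "\<dots> \<le> C * min_len q1 * (K' + 1)" using C by (intro mult_le_mono1) simp
  also have "\<dots> = min_len q1 * K" by (simp add: K algebra_simps)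
  also have "\<dots> \<le> length (subst_word (it q1) v)"
    using length_subst_word_ge[of "min_len q1" "it q1" v] min_len_le v(1) by simp
  finally have fit: "e + length u \<le> length (subst_word (it q1) v)" .
  have v': "subst_word (it q1) v' = u @ subst_word (it q1) (drop K' v')"
    unfolding u_def by (simp flip: subst_word_simps(3))
  have "subst_word (it q1) v ! (e + i) = u ! i" if "i < length u" for i
  proof -
    have "subst_word (it q1) v ! (e + i) = z (A1 + int (e + i))"
      by (rule reads_nth[OF g1, symmetric]) (use fit that in simp)
    also have "\<dots> = w (B1 + int i)" using zw[of "B1 + int i"] pos1 by (simp add: e(1) add.assoc)
    also have "\<dots> = subst_word (it q1) v' ! i"
      by (rule reads_nth[OF h1]) (use that v' in simp)
    finally show ?thesis using that by (simp add: v' nth_append)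
  qed
  then have "take (length u) (drop e (subst_word (it q1) v)) = u"
    using fit by (intro nth_equalityI) auto
  \<comment> \<open>This relates only the words \<open>v\<close> and \<open>v'\<close>. The same
    words follow the cuts \<open>A2\<close> and \<open>B2\<close>, so its image under the iterate
    \<open>p\<close> is available there.\<close>
  then obtain suf where split: "subst_word (it q1) v = pre @ u @ suf"
    unfolding pre_def by (metis append_take_drop_id)
  have eq: "it (p + q1) = (\<lambda>a. subst_word (it p) (it q1 a))" by (simp add: subst_iter_add fun_eq_iff)
  obtain g where g: "parse (it p) z g" "reads (it p) g A2 (subst_word (it q1) v)"
    using parse_refine[of "it p" "it q1" z g2] it_ne g2 unfolding eq by metis
  obtain h where h: "parse (it p) w h" "reads (it p) h B2 (subst_word (it q1) v')"
    using parse_refine[of "it p" "it q1" w h2] it_ne h2 unfolding eq by metis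
  define D where "D = int (length (subst_word (it p) pre))"
  have gu: "reads (it p) g (A2 + D) u" using g(2) by (simp add: split reads_append D_def)
  have hu: "reads (it p) h B2 u" using h(2) by (simp add: v' reads_append)
  have "take K' v' \<noteq> []" using v(2) K'_K(1) by (cases v') (auto simp: K')
  then have "u \<noteq> []" unfolding u_def using it_ne by (cases "take K' v'") auto
  then obtain a where a: "g (A2 + D) = (a, 0)" "h B2 = (a, 0)" using gu hu by (cases u) auto
  \<comment> \<open>The word \<open>Y\<close> occurs in \<open>z\<close> at \<open>A2 + D\<close>
    and in \<open>w\<close> at \<open>B2\<close>. If these positions differ, their distance
    \<open>d\<close> is a period of \<open>z\<close> along \<open>Y\<close>, which bounds the length
    of \<open>Y\<close> by \<open>Kr * d\<close>.\<close>
  have "A2 + D = B2"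
  proof (rule ccontr)
    assume ne: "A2 + D \<noteq> B2"
    define d where "d = nat \<bar>A2 + D - B2\<bar>"
    define b where "b = min (A2 + D) B2"
    define Y where "Y = subst_word (it p) u"
    have D0: "D \<ge> 0" by (simp add: D_def)
    have rep: "z (b + int i) = z (b + int i + int d)" if "i < length Y" for i
    proof -
      have "z (A2 + D + int i) = Y ! i" using reads_nth[OF g(1) gu, of i] that by (simp add: Y_def)
      moreover have "w (B2 + int i) = Y ! i" using reads_nth[OF h(1) hu, of i] that by (simp add: Y_def)
      moreover have "z (B2 + int i) = w (B2 + int i)" using zw pos2 by simp
      moreover have "(b = A2 + D \<and> b + int d = B2) \<or> (b = B2 \<and> b + int d = A2 + D)"
        unfolding b_def d_def by linarith
      ultimately show ?thesis by (metis add.commute add.left_commute)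
    qed
    have "d \<ge> 1" using ne by (simp add: d_def)
    from Kr[OF z this, of b] obtain s where s: "b \<le> s" "s \<le> b + int (Kr * d)" "z s \<noteq> z (s + int d)" by blast
    then have "\<not> nat (s - b) < length Y" using rep[of "nat (s - b)"] by auto
    then have lenY: "length Y \<le> Kr * d" using s by linarith
    \<comment> \<open>\<open>pre\<close> lies in the image of the first \<open>C\<close> letters of
      \<open>v\<close>, so \<open>d\<close> is at most \<open>C + 1\<close> maximal block lengths of
      level \<open>p + q1\<close>. As \<open>Y\<close> consists of \<open>K'\<close> such blocks,
      the choice of \<open>K'\<close> gives a contradiction.\<close>
    have "e \<le> C * min_len q1" using e(2) C order_trans by blast
    also have "\<dots> \<le> length (subst_word (it q1) (take C v))"
      using length_subst_word_ge[of "min_len q1" "it q1" "take C v"] min_len_le v(1) K'_K by (simp add: mult.commute)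
    finally have "e \<le> length (subst_word (it q1) (take C v))" .
    moreover have "subst_word (it q1) v = subst_word (it q1) (take C v) @ subst_word (it q1) (drop C v)"
      by (simp flip: subst_word_simps(3))
    ultimately have pre: "pre = take e (subst_word (it q1) (take C v))" by (simp add: pre_def)
    have comp: "subst_word (it p) (subst_word (it q1) x) = subst_word (it (p + q1)) x" for x
      by (induction x) (simp_all add: subst_iter_add)
    have "length (subst_word (it p) pre) \<le> length (subst_word (it p) (subst_word (it q1) (take C v)))"
    proof -
      have "subst_word W y = subst_word W (take e y) @ subst_word W (drop e y)" for W :: "'a \<Rightarrow> 'a list" and y
        by (simp flip: subst_word_simps(3))
      from arg_cong[OF this, of length] show ?thesis unfolding pre by (metis length_append le_add1)
    qed
    also have "\<dots> \<le> max_len (p + q1) * C"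
      unfolding comp using length_subst_word_le[of "it (p + q1)" "max_len (p + q1)" "take C v"] le_max_len v(1) K'_K
      by simp
    finally have "D \<le> int (max_len (p + q1) * C)" unfolding D_def of_nat_le_iff .
    then have "int d \<le> int (max_len (p + q1) * C) + int (max_len (p + q1))"
      using pos2 D0 unfolding d_def by linarith
    then have "int d \<le> int (max_len (p + q1) * (C + 1))" by (simp add: algebra_simps)
    then have "d \<le> max_len (p + q1) * (C + 1)" by (simp only: of_nat_le_iff)
    also have "\<dots> \<le> C * min_len (p + q1) * (C + 1)" using C by (intro mult_le_mono1) simp
    finally have "Kr * d \<le> Kr * (C * min_len (p + q1) * (C + 1))" by (rule mult_le_mono2)
    also have "\<dots> = Kr * (C + 1) * C * min_len (p + q1)" by (simp only: ac_simps)
    finally have "length Y \<le> Kr * (C + 1) * C * min_len (p + q1)" using lenY by simp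
    moreover have "K' * min_len (p + q1) \<le> length Y"
      unfolding Y_def u_def comp
      using length_subst_word_ge[of "min_len (p + q1)" "it (p + q1)" "take K' v'"] min_len_le v(2) K'_K
      by (simp add: mult.commute)
    moreover have "K' * min_len (p + q1) = Kr * (C + 1) * C * min_len (p + q1) + min_len (p + q1)"
      by (simp only: K' add_mult_distrib mult_1)
    ultimately show False using min_len_pos[of "p + q1"] by linarith
  qed
  then show thesis using that[OF g(1) h(1) pos2(2)] a by simp
qed

definition synchronized :: "nat \<Rightarrow> (int \<Rightarrow> 'a) \<Rightarrow> (int \<Rightarrow> 'a) \<Rightarrow> bool" where
  "synchronized p z w \<longleftrightarrow> (\<exists>g h s a. parse (it p) z g \<and> parse (it p) w h \<and> s \<ge> 0 \<and> g s = (a, 0) \<and> h s = (a, 0))"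

text \<open>The \<open>K\<close> letters following chosen cuts near \<open>0\<close> take finitely
  many values, so they coincide at two levels \<open>q1\<close> and \<open>p + q1\<close> with
  \<open>p \<ge> m\<close>. Coding all pairs at once yields the same \<open>p\<close> for all of
  them.\<close>

lemma synchronized_levels:
  fixes N :: nat
  assumes z: "\<And>i. i \<le> N \<Longrightarrow> z i \<in> X" and w: "\<And>i. i \<le> N \<Longrightarrow> w i \<in> X"
    and zw: "\<And>i t. i \<le> N \<Longrightarrow> t \<ge> 0 \<Longrightarrow> z i t = w i t"
  shows "\<exists>p\<ge>m. \<forall>i\<le>N. synchronized p (z i) (w i)"
proof -
  obtain C where C: "C \<ge> 1" "\<And>q. max_len q \<le> C * min_len q" using max_len_le_min_len by blast
  obtain Kr where Kr: "Kr \<ge> 1"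
    "\<And>x d t. x \<in> X \<Longrightarrow> d \<ge> 1 \<Longrightarrow> \<exists>s. t \<le> s \<and> s \<le> t + int (Kr * d) \<and> x s \<noteq> x (s + int d)"
    using no_long_repetition by blast
  define K' K where K': "K' = Kr * (C + 1) * C + 1" and K: "K = C * (K' + 1)"
  have ex: "\<exists>g A v. parse (it q) x g \<and> 0 \<le> A \<and> A \<le> int (max_len q) \<and> length v = K \<and> reads (it q) g A v"
    if "x \<in> X" for q x
  proof -
    obtain g where g: "parse (it q) x g" using parse_exists[OF \<open>x \<in> X\<close>] by blast
    obtain A where "0 \<le> A" "A \<le> 0 + int (max_len q)" "snd (g A) = 0"
      using parse_cut[OF g le_max_len] by blast
    then show ?thesis using g parse_reads[OF g, of A K] by auto
  qed
  have "\<forall>q x. \<exists>g A v. x \<in> X \<longrightarrow> parse (it q) x g \<and> 0 \<le> A \<and> A \<le> int (max_len q) \<and> length v = K \<and> reads (it q) g A v"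
    using ex by blast
  then obtain g A v where gAv: "\<And>q x. x \<in> X \<Longrightarrow> parse (it q) x (g q x) \<and> 0 \<le> A q x \<and>
      A q x \<le> int (max_len q) \<and> length (v q x) = K \<and> reads (it q) (g q x) (A q x) (v q x)"
    unfolding choice_iff by blast
  define code where "code q = map (\<lambda>i. (v q (z i), v q (w i))) [0..<Suc N]" for q
  let ?L = "{xs :: 'a list. set xs \<subseteq> UNIV \<and> length xs = K}"
  have "finite ?L" by (rule finite_lists_length_eq) simp
  then have "finite (?L \<times> ?L)" by simp
  then have "finite {cs. set cs \<subseteq> ?L \<times> ?L \<and> length cs = Suc N}"
    by (rule finite_lists_length_eq)
  moreover have "range code \<subseteq> {cs. set cs \<subseteq> ?L \<times> ?L \<and> length cs = Suc N}"
    using gAv z w by (auto simp: code_def less_Suc_eq_le simp del: upt_Suc)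
  ultimately have "finite (range code)" by (rule finite_subset[rotated])
  from pigeonhole_infinite[OF infinite_UNIV_nat this] obtain q1 where "infinite {q. code q = code q1}"
    by auto
  then obtain q where "q \<ge> m + q1" and code: "code q = code q1"
    unfolding infinite_nat_iff_unbounded_le by blast
  define p where "p = q - q1"
  have p: "q = p + q1" "p \<ge> m" using \<open>q \<ge> m + q1\<close> by (auto simp: p_def)
  have "synchronized p (z i) (w i)" if i: "i \<le> N" for i
  proof -
    have veq: "v q (z i) = v q1 (z i)" "v q (w i) = v q1 (w i)"
      using code i unfolding code_def by (auto simp: map_eq_conv less_Suc_eq_le simp del: upt_Suc)
    note Z = gAv[OF z[OF i]] and Wi = gAv[OF w[OF i]]
    show ?thesis
    proof (cases "A q1 (z i) \<le> A q1 (w i)")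
      case True
      show ?thesis
        by (rule aligned_cut[OF C(2) Kr(2) K' K z[OF i] zw[OF i], of "v q1 (z i)" "v q1 (w i)" q1
              "g q1 (z i)" "A q1 (z i)" "g q1 (w i)" "A q1 (w i)" p "g q (z i)" "A q (z i)" "g q (w i)" "A q (w i)"])
          (use Z[of q1] Z[of q] Wi[of q1] Wi[of q] True veq p in \<open>auto simp: synchronized_def\<close>)
    next
      case False
      show ?thesis
        by (rule aligned_cut[OF C(2) Kr(2) K' K w[OF i] zw[OF i, symmetric], of "v q1 (w i)" "v q1 (z i)" q1
              "g q1 (w i)" "A q1 (w i)" "g q1 (z i)" "A q1 (z i)" p "g q (w i)" "A q (w i)" "g q (z i)" "A q (z i)"])
          (use Z[of q1] Z[of q] Wi[of q1] Wi[of q] False veq p in \<open>auto simp: synchronized_def\<close>)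
    qed
  qed
  then show ?thesis using p(2) by blast
qed

text \<open>At a synchronized level with blocks of at least \<open>n\<close> letters, the k^2 + 1
  pairs pass through at most k^2 branch vertices at \<open>0\<close>, so two of them share their
  first \<open>n\<close> letters.\<close>

lemma asymptotic_collision:
  assumes z: "\<And>i. i \<le> CARD('a)\<^sup>2 \<Longrightarrow> z i \<in> X" and w: "\<And>i. i \<le> CARD('a)\<^sup>2 \<Longrightarrow> w i \<in> X"
    and zw: "\<And>i t. i \<le> CARD('a)\<^sup>2 \<Longrightarrow> t \<ge> 0 \<Longrightarrow> z i t = w i t"
    and diff: "\<And>i. i \<le> CARD('a)\<^sup>2 \<Longrightarrow> z i (-1) \<noteq> w i (-1)"
  obtains i j where "i < j" "j \<le> CARD('a)\<^sup>2" "\<And>t. t \<ge> 0 \<Longrightarrow> z i t = z j t"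
proof -
  let ?N = "CARD('a)\<^sup>2"
  have step: "\<exists>i j. i < j \<and> j \<le> ?N \<and> (\<forall>t<n. z i (int t) = z j (int t))" for n
  proof -
    obtain q where q: "\<And>a. n \<le> length (it q a)" using length_it_growth by blast
    obtain p where p: "p \<ge> q" "\<forall>i\<le>?N. synchronized p (z i) (w i)"
      using synchronized_levels[of ?N z w q] z w zw by blast
    have n: "n \<le> length (it p a)" for a using q[of a] length_it_mono[OF p(1), of a] by simp
    show ?thesis
    proof (rule branch_classes[where W = "it p" and n = n, OF it_ne n])
      fix B :: "('a \<times> 'a \<times> nat) set" and f
      assume B: "finite B" "card B \<le> ?N"
        and inB: "\<And>z w g h s a. parse (it p) z g \<Longrightarrow> parse (it p) w h \<Longrightarrow> (\<And>t. t \<ge> 0 \<Longrightarrow> z t = w t) \<Longrightarrow>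
         z (-1) \<noteq> w (-1) \<Longrightarrow> s \<ge> 0 \<Longrightarrow> g s = (a, 0) \<Longrightarrow> h s = (a, 0) \<Longrightarrow> f (parse_vertex (it p) g 0) \<in> B"
        and tail: "\<And>z z' g g' i. parse (it p) z g \<Longrightarrow> parse (it p) z' g' \<Longrightarrow>
         f (parse_vertex (it p) g 0) = f (parse_vertex (it p) g' 0) \<Longrightarrow> i < n \<Longrightarrow> z (int i) = z' (int i)"
      have "\<exists>g. parse (it p) (z i) g \<and> f (parse_vertex (it p) g 0) \<in> B" if i: "i \<le> ?N" for i
      proof -
        obtain g h s a where "parse (it p) (z i) g" "parse (it p) (w i) h" "s \<ge> 0" "g s = (a, 0)" "h s = (a, 0)"
          using p(2) i unfolding synchronized_def by blast
        with inB[OF this(1,2) zw[OF i] diff[OF i]] show ?thesis by blast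
      qed
      then have "\<forall>i. \<exists>g. i \<le> ?N \<longrightarrow> parse (it p) (z i) g \<and> f (parse_vertex (it p) g 0) \<in> B"
        by blast
      then obtain g where g: "\<And>i. i \<le> ?N \<Longrightarrow> parse (it p) (z i) (g i)"
        "\<And>i. i \<le> ?N \<Longrightarrow> f (parse_vertex (it p) (g i) 0) \<in> B" by metis
      have "\<not> inj_on (\<lambda>i. f (parse_vertex (it p) (g i) 0)) {..?N}"
      proof
        assume "inj_on (\<lambda>i. f (parse_vertex (it p) (g i) 0)) {..?N}"
        then have "card {..?N} \<le> card B" by (rule card_inj_on_le) (use g(2) B(1) in auto)
        then show False using B(2) by simp
      qed
      then obtain i j where ij: "i \<le> ?N" "j \<le> ?N" "i \<noteq> j"
        and eq: "f (parse_vertex (it p) (g i) 0) = f (parse_vertex (it p) (g j) 0)"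
        unfolding inj_on_def by auto
      have "z i (int t) = z j (int t)" if "t < n" for t
        using tail[OF g(1)[OF ij(1)] g(1)[OF ij(2)] eq that] .
      then show ?thesis using ij by (metis linorder_neqE_nat)
    qed
  qed
  then obtain ii jj where ij: "\<And>n. ii n < jj n \<and> jj n \<le> ?N \<and> (\<forall>t<n. z (ii n) (int t) = z (jj n) (int t))"
    by metis
  have "(\<lambda>n. (ii n, jj n)) ` UNIV \<subseteq> {..?N} \<times> {..?N}"
  proof
    fix c assume "c \<in> (\<lambda>n. (ii n, jj n)) ` UNIV"
    then obtain n where "c = (ii n, jj n)" by blast
    then show "c \<in> {..?N} \<times> {..?N}" using ij[of n] by simp
  qed
  then have "finite ((\<lambda>n. (ii n, jj n)) ` UNIV)" by (rule finite_subset) simp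
  \<comment> \<open>One pair of indices serves infinitely many \<open>n\<close>, hence the whole
    half-line.\<close>
  from pigeonhole_infinite[OF infinite_UNIV_nat this] obtain n0 where
    inf: "infinite {n. (ii n, jj n) = (ii n0, jj n0)}" by auto
  have "z (ii n0) t = z (jj n0) t" if "t \<ge> 0" for t
  proof -
    obtain n where "n \<ge> Suc (nat t)" "(ii n, jj n) = (ii n0, jj n0)"
      using inf unfolding infinite_nat_iff_unbounded_le by blast
    then show ?thesis using ij[of n] that by (auto dest!: spec[of _ "nat t"])
  qed
  then show thesis using that ij[of n0] by blast
qed

section \<open>Automorphisms\<close>

lemma limit_mem:
  assumes "\<And>N. \<exists>y\<in>X. \<forall>t\<in>{- int N..int N}. y t = x t"
  shows "x \<in> X"
proof -
  have "\<exists>m\<ge>1. \<exists>a. sublist (map x [i..j]) (it m a)" for i j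
  proof -
    obtain y where y: "y \<in> X" "\<forall>t\<in>{- int (nat (\<bar>i\<bar> + \<bar>j\<bar>))..int (nat (\<bar>i\<bar> + \<bar>j\<bar>))}. y t = x t"
      using assms by blast
    have "x t = y t" if "i \<le> t" "t \<le> j" for t using bspec[OF y(2), of t] that by fastforce
    then have "map x [i..j] = map y [i..j]" by simp
    moreover have "\<exists>m\<ge>1. \<exists>a. sublist (map y [i..j]) (it m a)" using y(1) unfolding subst_shift_def by blast
    ultimately show ?thesis by metis
  qed
  then show ?thesis by (simp add: subst_shift_def)
qed

text \<open>Otherwise, by compactness, boundedly many letters determine the letter to their left, so that
  a repeated block propagates to a period of a left half-line.\<close>

lemma asymptotic_pair: obtains x y where "x \<in> X" "y \<in> X" "\<And>t. t \<ge> 0 \<Longrightarrow> x t = y t" "x (-1) \<noteq> y (-1)"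
proof -
  have "\<exists>x\<in>X. \<exists>y\<in>X. (\<forall>t\<ge>0. x t = y t) \<and> x (-1) \<noteq> y (-1)"
  proof (rule ccontr)
    assume none: "\<not> ?thesis"
    have "\<exists>N. \<forall>x\<in>X. \<forall>y\<in>X. (\<forall>t\<in>{0..int N}. x t = y t) \<longrightarrow> x (-1) = y (-1)"
    proof (rule ccontr)
      assume "\<not> ?thesis"
      then have "\<forall>N. \<exists>x y. x \<in> X \<and> y \<in> X \<and> (\<forall>t\<in>{0..int N}. x t = y t) \<and> x (-1) \<noteq> y (-1)" by blast
      then obtain x y where xy: "\<And>N. x N \<in> X \<and> y N \<in> X \<and> (\<forall>t\<in>{0..int N}. x N t = y N t) \<and> x N (-1) \<noteq> y N (-1)"
        by metis
      \<comment> \<open>A limit of counterexamples for growing \<open>N\<close> would be an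
        asymptotic pair.\<close>
      obtain g where g: "\<And>N. \<exists>n\<ge>N. \<forall>t\<in>{- int N..int N}. (x n t, y n t) = g t"
        using cluster_point[of UNIV "\<lambda>n t. (x n t, y n t)"] by auto
      have "fst \<circ> g \<in> X"
      proof (rule limit_mem)
        fix N
        obtain n where n: "\<forall>t\<in>{- int N..int N}. (x n t, y n t) = g t" using g by blast
        have "\<forall>t\<in>{- int N..int N}. x n t = (fst \<circ> g) t" using n by (metis comp_apply fst_conv)
        then show "\<exists>z\<in>X. \<forall>t\<in>{- int N..int N}. z t = (fst \<circ> g) t" using xy by blast
      qed
      moreover have "snd \<circ> g \<in> X"
      proof (rule limit_mem)
        fix N
        obtain n where n: "\<forall>t\<in>{- int N..int N}. (x n t, y n t) = g t" using g by blast
        have "\<forall>t\<in>{- int N..int N}. y n t = (snd \<circ> g) t" using n by (metis comp_apply snd_conv)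
        then show "\<exists>z\<in>X. \<forall>t\<in>{- int N..int N}. z t = (snd \<circ> g) t" using xy by blast
      qed
      moreover have "(fst \<circ> g) t = (snd \<circ> g) t" if "t \<ge> 0" for t
      proof -
        obtain n where n: "n \<ge> nat t" "\<forall>s\<in>{- int (nat t)..int (nat t)}. (x n s, y n s) = g s" using g by blast
        then have "g t = (x n t, y n t)" using that by auto
        moreover have "x n t = y n t" using xy[of n] n(1) that by auto
        ultimately show ?thesis by simp
      qed
      moreover have "(fst \<circ> g) (-1) \<noteq> (snd \<circ> g) (-1)"
      proof -
        obtain n where n: "\<forall>s\<in>{- int 1..int 1}. (x n s, y n s) = g s" using g by blast
        then have "g (-1) = (x n (-1), y n (-1))" by auto
        then show ?thesis using xy[of n] by simp
      qed
      ultimately show False using none by blast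
    qed
    then obtain N where N: "\<And>x y. x \<in> X \<Longrightarrow> y \<in> X \<Longrightarrow> (\<And>t. 0 \<le> t \<Longrightarrow> t \<le> int N \<Longrightarrow> x t = y t) \<Longrightarrow> x (-1) = y (-1)"
      by (metis atLeastAtMost_iff)
    obtain x where x: "x \<in> X" using inf by (metis finite.emptyI ex_in_conv)
    define win where "win n = map (\<lambda>s. x (int n + int s)) [0..<Suc N]" for n
    have "finite (range win)"
      by (rule finite_subset[OF _ finite_lists_length_eq[of UNIV "Suc N"]]) (auto simp: win_def)
    then have "\<not> inj win" using finite_imageD infinite_UNIV_nat by blast
    then obtain i j where ij: "i < j" "win i = win j"
      unfolding inj_def by (metis linorder_neqE_nat)
    define d where "d = j - i"
    have win: "x (int i + t) = x (int i + int d + t)" if "0 \<le> t" "t \<le> int N" for t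
    proof -
      have "win i ! nat t = win j ! nat t" "nat t < Suc N" using ij that by auto
      then show ?thesis using that ij(1) by (simp add: win_def d_def of_nat_diff del: upt_Suc)
    qed
    \<comment> \<open>Leftward induction: the repeated block gives the first \<open>N + 1\<close>
      equalities; from then on, \<open>N + 1\<close> equal letters force the letters to their left
      to be equal.\<close>
    have bwd: "x (int i + int N - int s) = x (int i + int d + int N - int s)" for s
    proof (induction s rule: less_induct)
      case (less s)
      show ?case
      proof (cases "s \<le> N")
        case True
        then show ?thesis using win[of "int N - int s"] by (simp add: algebra_simps)
      next
        case False
        define c where "c = int i + int N - int s + 1"
        have "x (t + c) = x (t + (c + int d))" if "0 \<le> t" "t \<le> int N" for t
        proof -
          have "s - Suc (nat t) < s" using False that by linarith
          from less.IH[OF this] show ?thesis using False that by (simp add: c_def algebra_simps of_nat_diff)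
        qed
        from N[OF translate_mem[OF x, of c] translate_mem[OF x, of "c + int d"] this]
        show ?thesis by (simp add: c_def algebra_simps)
      qed
    qed
    obtain K where K: "K \<ge> 1" "\<And>x d t. x \<in> X \<Longrightarrow> d \<ge> 1 \<Longrightarrow> \<exists>s. t \<le> s \<and> s \<le> t + int (K * d) \<and> x s \<noteq> x (s + int d)"
      using no_long_repetition by blast
    have "d \<ge> 1" using ij(1) by (simp add: d_def)
    \<comment> \<open>The start is chosen so that the interval searched ends at
      \<open>i + N\<close>, within the range of \<open>bwd\<close>.\<close>
    from K(2)[OF x this, of "int i + int N - int (K * d)"] obtain s where
      "s \<le> int i + int N" "x s \<noteq> x (s + int d)" by auto
    then show False using bwd[of "nat (int i + int N - s)"] by (simp add: algebra_simps)
  qed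
  then show thesis using that by blast
qed

section \<open>Automorphisms as block codes\<close>

lemma automorphism_power: "shift_automorphism X \<Phi> \<Longrightarrow> shift_automorphism X (\<Phi> ^^ m)"
proof (induction m)
  case 0
  then show ?case using bij_betw_id[of X] by (simp add: shift_automorphism_def id_def)
next
  case (Suc m)
  then have b: "bij_betw \<Phi> X X" and "bij_betw (\<Phi> ^^ m) X X" by (auto simp: shift_automorphism_def)
  moreover have "(\<Phi> ^^ m) x \<in> X" if "x \<in> X" for x
    using \<open>bij_betw (\<Phi> ^^ m) X X\<close> that by (auto simp: bij_betw_def)
  moreover have "bij_betw (\<Phi> \<circ> \<Phi> ^^ m) X X" using calculation(1,2) bij_betw_trans by blast
  moreover have "continuous_map (subtopology seq_topology X) (subtopology seq_topology X) (\<Phi> \<circ> \<Phi> ^^ m)"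
    using Suc continuous_map_compose unfolding shift_automorphism_def by blast
  ultimately show ?case using Suc by (simp add: shift_automorphism_def comp_def)
qed

lemma automorphism_mem: "shift_automorphism X \<Phi> \<Longrightarrow> x \<in> X \<Longrightarrow> \<Phi> x \<in> X"
  by (auto simp: shift_automorphism_def bij_betw_def)

lemma automorphism_translate:
  assumes \<Phi>: "shift_automorphism X \<Phi>" and x: "x \<in> X"
  shows "\<Phi> (\<lambda>i. x (i + n)) = (\<lambda>i. \<Phi> x (i + n))"
proof -
  have pos: "\<Phi> (\<lambda>i. x (i + int k)) = (\<lambda>i. \<Phi> x (i + int k))" if "x \<in> X" for x k
  proof (induction k)
    case (Suc k)
    have "(\<lambda>i. x (i + int (Suc k))) = shift (\<lambda>i. x (i + int k))" by (simp add: shift_def algebra_simps)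
    then have "\<Phi> (\<lambda>i. x (i + int (Suc k))) = shift (\<Phi> (\<lambda>i. x (i + int k)))"
      using \<Phi> translate_mem[OF that] unfolding shift_automorphism_def by metis
    then show ?case by (simp add: Suc shift_def algebra_simps)
  qed simp
  show ?thesis
  proof (cases "n \<ge> 0")
    case True
    then show ?thesis using pos[OF x, of "nat n"] by simp
  next
    case False
    define y where "y = (\<lambda>i. x (i + n))"
    have "\<Phi> x = (\<lambda>i. \<Phi> y (i - n))"
      using pos[OF translate_mem[OF x, of n], of "nat (- n)"] False by (simp add: y_def)
    then show ?thesis by (simp add: y_def fun_eq_iff)
  qed
qed

lemma openin_agreement:
  assumes "openin seq_topology T" "x \<in> T"
  obtains R where "\<And>y. (\<And>t. \<bar>t\<bar> \<le> int R \<Longrightarrow> y t = x t) \<Longrightarrow> y \<in> T"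
proof -
  obtain U where U: "finite {i. U i \<noteq> UNIV}" "x \<in> (\<Pi>\<^sub>E i\<in>UNIV. U i)" "(\<Pi>\<^sub>E i\<in>UNIV. U i) \<subseteq> T"
    using assms unfolding seq_topology_def openin_product_topology_alt by auto
  obtain R where R: "\<And>i. i \<in> {i. U i \<noteq> UNIV} \<Longrightarrow> nat \<bar>i\<bar> \<le> R"
    using finite_nat_set_iff_bounded_le[of "(\<lambda>i. nat \<bar>i\<bar>) ` {i. U i \<noteq> UNIV}"] U(1) by blast
  show thesis
  proof (rule that)
    fix y assume y: "\<And>t. \<bar>t\<bar> \<le> int R \<Longrightarrow> y t = x t"
    have "y i \<in> U i" for i
    proof (cases "U i = UNIV")
      case False
      then have "y i = x i" using R[of i] y[of i] by auto
      then show ?thesis using U(2) by auto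
    qed simp
    then show "y \<in> T" using U(3) by (auto simp: PiE_UNIV_domain)
  qed
qed

text \<open>If no radius worked, pairs agreeing on growing windows with different image letters at
  \<open>0\<close> would cluster at one point \<open>g\<close>, contradicting continuity at
  \<open>g\<close>. Translations carry the rule from \<open>0\<close> to all positions.\<close>

lemma curtis_hedlund_lyndon:
  assumes \<Phi>: "shift_automorphism X \<Phi>"
  obtains R where "\<And>x y u v. x \<in> X \<Longrightarrow> y \<in> X \<Longrightarrow> (\<And>t. \<bar>t\<bar> \<le> int R \<Longrightarrow> x (u + t) = y (v + t)) \<Longrightarrow> \<Phi> x u = \<Phi> y v"
proof -
  have cont: "continuous_map (subtopology seq_topology X) seq_topology \<Phi>"
    using \<Phi> continuous_map_into_fulltopology unfolding shift_automorphism_def by blast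
  have eval: "continuous_map seq_topology (discrete_topology UNIV) (\<lambda>x. x 0)"
    unfolding seq_topology_def by (rule continuous_map_product_projection) simp
  have ev: "continuous_map (subtopology seq_topology X) (discrete_topology UNIV) (\<lambda>x. \<Phi> x 0)"
    using continuous_map_compose[OF cont eval] by (simp add: o_def)
  have "\<exists>R. \<forall>x\<in>X. \<forall>y\<in>X. (\<forall>t\<in>{- int R..int R}. x t = y t) \<longrightarrow> \<Phi> x 0 = \<Phi> y 0"
  proof (rule ccontr)
    assume "\<not> ?thesis"
    then have "\<forall>N. \<exists>x y. x \<in> X \<and> y \<in> X \<and> (\<forall>t\<in>{- int N..int N}. x t = y t) \<and> \<Phi> x 0 \<noteq> \<Phi> y 0" by blast
    then obtain x y where xy: "\<And>N. x N \<in> X \<and> y N \<in> X \<and> (\<forall>t\<in>{- int N..int N}. x N t = y N t) \<and> \<Phi> (x N) 0 \<noteq> \<Phi> (y N) 0"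
      by metis
    obtain g where g: "\<And>N. \<exists>n\<ge>N. \<forall>t\<in>{- int N..int N}. x n t = g t"
      using cluster_point[of UNIV x] by auto
    have gX: "g \<in> X"
      by (rule limit_mem) (use g xy in blast)
    have "openin (subtopology seq_topology X) {x \<in> topspace (subtopology seq_topology X). \<Phi> x 0 \<in> {\<Phi> g 0}}"
      by (rule openin_continuous_map_preimage[OF ev]) simp
    then obtain T where T: "openin seq_topology T"
      "{x \<in> topspace (subtopology seq_topology X). \<Phi> x 0 \<in> {\<Phi> g 0}} = T \<inter> X"
      unfolding openin_subtopology by blast
    have top: "topspace (subtopology seq_topology X) = X" by (simp add: seq_topology_def)
    have "g \<in> T" using T(2) gX unfolding top by blast
    from openin_agreement[OF T(1) this] obtain R where R: "\<And>y. (\<And>t. \<bar>t\<bar> \<le> int R \<Longrightarrow> y t = g t) \<Longrightarrow> y \<in> T"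
      by blast
    obtain n where n: "n \<ge> R" "\<forall>t\<in>{- int R..int R}. x n t = g t" using g by blast
    have "x n \<in> T"
    proof (rule R)
      fix t :: int assume "\<bar>t\<bar> \<le> int R"
      then have "t \<in> {- int R..int R}" by auto
      then show "x n t = g t" using n(2) by blast
    qed
    moreover have "y n \<in> T"
    proof (rule R)
      fix t :: int assume t: "\<bar>t\<bar> \<le> int R"
      then have "t \<in> {- int n..int n}" using n(1) by auto
      then have "x n t = y n t" using xy[of n] by blast
      moreover have "t \<in> {- int R..int R}" using t by auto
      ultimately show "y n t = g t" using n(2) by simp
    qed
    ultimately have "\<Phi> (x n) 0 = \<Phi> g 0" "\<Phi> (y n) 0 = \<Phi> g 0" using T(2) xy[of n] unfolding top by blast+
    then show False using xy[of n] by simp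
  qed
  then obtain R where R: "\<And>x y. x \<in> X \<Longrightarrow> y \<in> X \<Longrightarrow> (\<forall>t\<in>{- int R..int R}. x t = y t) \<Longrightarrow> \<Phi> x 0 = \<Phi> y 0"
    by blast
  show thesis
  proof (rule that)
    fix x y u v assume x: "x \<in> X" and y: "y \<in> X" and xy: "\<And>t. \<bar>t\<bar> \<le> int R \<Longrightarrow> x (u + t) = y (v + t)"
    have "\<Phi> (\<lambda>i. x (i + u)) 0 = \<Phi> (\<lambda>i. y (i + v)) 0"
      by (rule R[OF translate_mem[OF x] translate_mem[OF y]]) (use xy in \<open>auto simp: add.commute\<close>)
    then show "\<Phi> x u = \<Phi> y v" using automorphism_translate[OF \<Phi>] x y by simp
  qed
qed

text \<open>By recurrence every window of \<open>y\<close> occurs in \<open>x\<close> to the right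
  of \<open>T\<close>, and the local rule carries the identity over to \<open>y\<close>.\<close>

lemma eq_shift_power:
  assumes \<Psi>: "shift_automorphism X \<Psi>" and x: "x \<in> X"
    and tail: "\<And>t. t \<ge> T \<Longrightarrow> \<Psi> x t = x (t + n)" and y: "y \<in> X"
  shows "\<Psi> y = shift_power n y"
proof
  fix u
  obtain R where R: "\<And>x y u v. x \<in> X \<Longrightarrow> y \<in> X \<Longrightarrow> (\<And>t. \<bar>t\<bar> \<le> int R \<Longrightarrow> x (u + t) = y (v + t)) \<Longrightarrow> \<Psi> x u = \<Psi> y v"
    using curtis_hedlund_lyndon[OF \<Psi>] by blast
  \<comment> \<open>The radius covers both the local rule and the letter at distance
    \<open>n\<close>.\<close>
  define S where "S = Suc (R + nat \<bar>n\<bar>)"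
  obtain K where K: "K \<ge> 1" "\<And>n x y t i. n \<ge> 1 \<Longrightarrow> x \<in> X \<Longrightarrow> y \<in> X \<Longrightarrow>
     \<exists>t'. t \<le> t' \<and> t' \<le> t + int (K * n) \<and> (\<forall>s\<le>n. x (t' + int s) = y (i + int s))"
    using linear_recurrence by blast
  obtain t' where t': "T \<le> t'" "\<forall>s\<le>2 * S. x (t' + int s) = y (u - int S + int s)"
    using K(2)[OF _ x y, of "2 * S" T "u - int S"] by (auto simp: S_def)
  define c where "c = t' + int S"
  have xy: "x (c + s) = y (u + s)" if "\<bar>s\<bar> \<le> int S" for s
  proof -
    have S: "nat (s + int S) \<le> 2 * S" "int (nat (s + int S)) = s + int S" using that by auto
    have "c + s = t' + (s + int S)" "u + s = u - int S + (s + int S)" by (simp_all add: c_def)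
    then show ?thesis using t'(2)[rule_format, OF S(1)] unfolding S(2) by metis
  qed
  have "\<Psi> y u = \<Psi> x c" by (rule R[OF y x]) (use xy in \<open>auto simp: S_def\<close>)
  also have "\<dots> = x (c + n)" by (rule tail) (use t'(1) in \<open>simp add: c_def\<close>)
  also have "\<dots> = y (u + n)" by (rule xy) (auto simp: S_def)
  finally show "\<Psi> y u = shift_power n y u" by (simp add: shift_power_apply)
qed

end

theorem corollary4p4:
  fixes \<theta> :: "'a::finite \<Rightarrow> 'a list"
    and \<Phi> :: "(int \<Rightarrow> 'a) \<Rightarrow> (int \<Rightarrow> 'a)"
  assumes "substitution \<theta>"
    and "primitive \<theta>"
    and "infinite (subst_shift \<theta>)"
    and "shift_automorphism (subst_shift \<theta>) \<Phi>"
  shows "\<exists>(m::nat) (n::int). 1 \<le> m \<and> m \<le> CARD('a) ^ 2 \<and>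
           (\<forall>x\<in>subst_shift \<theta>. (\<Phi> ^^ m) x = shift_power n x)"
proof -
  interpret primitive_aperiodic \<theta> by unfold_locales fact+
  let ?N = "CARD('a)\<^sup>2"
  obtain x y where xy: "x \<in> X" "y \<in> X" "\<And>t. t \<ge> 0 \<Longrightarrow> x t = y t" "x (-1) \<noteq> y (-1)"
    using asymptotic_pair by blast
  have aut: "shift_automorphism X (\<Phi> ^^ i)" for i by (rule automorphism_power[OF assms(4)])
  have "\<exists>D. (\<Phi> ^^ i) x (D - 1) \<noteq> (\<Phi> ^^ i) y (D - 1) \<and> (\<forall>t\<ge>D. (\<Phi> ^^ i) x t = (\<Phi> ^^ i) y t)" for i
  proof -
    obtain R where R: "\<And>x y u v. x \<in> X \<Longrightarrow> y \<in> X \<Longrightarrow> (\<And>t. \<bar>t\<bar> \<le> int R \<Longrightarrow> x (u + t) = y (v + t)) \<Longrightarrow> (\<Phi> ^^ i) x u = (\<Phi> ^^ i) y v"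
      using curtis_hedlund_lyndon[OF aut] by blast
    have agree: "(\<Phi> ^^ i) x t = (\<Phi> ^^ i) y t" if "t \<ge> int R" for t
      by (rule R[OF xy(1,2)]) (use that xy(3) in auto)
    have "(\<Phi> ^^ i) x \<noteq> (\<Phi> ^^ i) y"
      using aut[of i] xy(1,2,4) unfolding shift_automorphism_def bij_betw_def inj_on_def by metis
    from last_difference[OF this agree] show ?thesis by blast
  qed
  then obtain D where D: "\<And>i. (\<Phi> ^^ i) x (D i - 1) \<noteq> (\<Phi> ^^ i) y (D i - 1)"
    "\<And>i t. t \<ge> D i \<Longrightarrow> (\<Phi> ^^ i) x t = (\<Phi> ^^ i) y t" by metis
  \<comment> \<open>Translation by \<open>D i\<close> moves the last difference of the pair with
    index \<open>i\<close> to \<open>-1\<close>.\<close>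
  obtain i j where ij: "i < j" "j \<le> ?N" "\<And>t. t \<ge> 0 \<Longrightarrow> (\<Phi> ^^ i) x (t + D i) = (\<Phi> ^^ j) x (t + D j)"
  proof (rule asymptotic_collision[of "\<lambda>i t. (\<Phi> ^^ i) x (t + D i)" "\<lambda>i t. (\<Phi> ^^ i) y (t + D i)"])
    show "(\<lambda>t. (\<Phi> ^^ i) x (t + D i)) \<in> X" "(\<lambda>t. (\<Phi> ^^ i) y (t + D i)) \<in> X" for i
      using translate_mem automorphism_mem[OF aut] xy by blast+
    show "(\<Phi> ^^ i) x (-1 + D i) \<noteq> (\<Phi> ^^ i) y (-1 + D i)" for i using D(1)[of i] by simp
  qed (use D(2) in auto)
  define m where "m = j - i"
  have m: "1 \<le> m" "m \<le> ?N" "j = m + i" using ij(1,2) by (auto simp: m_def)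
  \<comment> \<open>The power of the shift is the offset between the two tails, and the point to
    which \<open>eq_shift_power\<close> is applied is \<open>(\<Phi> ^^ i) x\<close>.\<close>
  have "(\<Phi> ^^ m) z = shift_power (D i - D j) z" if "z \<in> X" for z
  proof (rule eq_shift_power[OF aut automorphism_mem[OF aut xy(1)] _ that])
    fix t assume "t \<ge> D j"
    then have "(\<Phi> ^^ j) x t = (\<Phi> ^^ i) x (t + (D i - D j))"
      using ij(3)[of "t - D j"] by (simp add: algebra_simps)
    then show "(\<Phi> ^^ m) ((\<Phi> ^^ i) x) t = (\<Phi> ^^ i) x (t + (D i - D j))"
      by (simp only: m(3) funpow_add comp_apply)
  qed
  then show ?thesis using m(1,2) by blast
qed

end
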